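(* Suppose $M$ is compact, and $\sigma$ is a section of $\mathcal E$ whose length $|\sigma|$ is not constant. Then for each $p\in\mathbb R$ there exists at most one $q\in\mathbb R$ such that $\sigma$ is a $(p,q)$-harmonic section of $\mathcal E$.
   Context: Setting: $(M,g)$ is a smooth, oriented, connected Riemannian manifold without boundary, and $\pi\colon\mathcal E\to M$ is a smooth oriented real vector bundle with a fibre metric $\langle\,,\rangle$ and a connection $\nabla$ for which the fibre metric is holonomy-invariant, i.e. $\nabla\langle\,,\rangle=0$. All sections are smooth. For a section $\sigma$, put $F=\tfrac12|\sigma|^2\colon M\to\mathbb R$, let $\nabla F$ be its gradient, and $|\nabla\sigma|^2=\sum_i|\nabla_{E_i}\sigma|^2$ for a local orthonormal tangent frame $\{E_i\}$. For $p,q\in\mathbb R$ define a symmetric 2-tensor on the total space $\mathcal E$ by $h_{p,q}(A,B)=g(d\pi(A),d\pi(B))+(1+|e|^2)^{-p}\big(\langle KA,KB\rangle+q\langle KA,e\rangle\langle KB,e\rangle\big)$ for $A,B\in T_e\mathcal E$, where $K\colon T\mathcal E\to\mathcal E$ is the connection map of $\nabla$. The vertical $(p,q)$-energy of $\sigma$ on compact $M$ (half the integral of the $h_{p,q}$-square norm of the vertical part of $d\sigma$) is $$E^v_{p,q}(\sigma)=\frac12\int_M\frac{1}{(1+|\sigma|^2)^p}\big(|\nabla\sigma|^2+q|\nabla F|^2\big)\,\mathrm{vol}(g).$$ $\sigma$ is a $(p,q)$-harmonic section of $\mathcal E$ if $\frac{d}{dt}\big|_{t=0}E^v_{p,q}(\sigma_t)=0$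 for every smooth variation $\sigma_t$ of $\sigma_0=\sigma$ through sections of $\mathcal E$. *)

theory Defs
  imports "HOL-Analysis.Analysis"
begin

section \<open>Smooth maps between open subsets of Euclidean spaces\<close>

fun Ck_on :: "nat \<Rightarrow> 'v::real_normed_vector set \<Rightarrow> ('v \<Rightarrow> 'w::real_normed_vector) \<Rightarrow> bool" where
  "Ck_on 0 S f \<longleftrightarrow> continuous_on S f"
| "Ck_on (Suc k) S f \<longleftrightarrow>
     (\<forall>x\<in>S. f differentiable (at x)) \<and>
     (\<forall>v. Ck_on k S (\<lambda>x. frechet_derivative f (at x) v))"

text \<open>Only used for open \<open>S\<close> (in a finite-dimensional space), where it is the usual \<open>C\<^sup>\<infinity>\<close>.\<close>

definition smooth_on :: "'v::real_normed_vector set \<Rightarrow> ('v \<Rightarrow> 'w::real_normed_vector) \<Rightarrow> bool" where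
  "smooth_on S f \<longleftrightarrow> (\<forall>k. Ck_on k S f)"


section \<open>Oriented smooth manifolds\<close>

text \<open>
  A chart is a pair \<open>(U, \<phi>)\<close>; only the values of \<open>\<phi>\<close> on the open set \<open>U\<close> matter. The manifold is
  the whole type \<open>'a\<close>, its dimension is \<open>CARD('n)\<close>, and it has no boundary because charts map onto
  open subsets of \<open>real ^ 'n\<close>. An orientation is given by an atlas whose coordinate changes have
  positive Jacobian determinant.
\<close>

type_synonym ('a, 'n) chart = "'a set \<times> ('a \<Rightarrow> real ^ 'n)"

locale oriented_manifold =
  fixes atlas :: "('a::{t2_space, second_countable_topology}, 'n::finite) chart set"
  assumes chart_open: "(U, \<phi>) \<in> atlas \<Longrightarrow> open U"
    and chart_image_open: "(U, \<phi>) \<in> atlas \<Longrightarrow> open (\<phi> ` U)"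
    and chart_homeomorphism:
      "(U, \<phi>) \<in> atlas \<Longrightarrow> homeomorphism U (\<phi> ` U) \<phi> (inv_into U \<phi>)"
    and charts_cover: "\<exists>(U, \<phi>)\<in>atlas. x \<in> U"
    and chart_change_smooth:
      "(U, \<phi>) \<in> atlas \<Longrightarrow> (V, \<phi>') \<in> atlas \<Longrightarrow> smooth_on (\<phi> ` (U \<inter> V)) (\<phi>' \<circ> inv_into U \<phi>)"
    and chart_change_oriented:
      "(U, \<phi>) \<in> atlas \<Longrightarrow> (V, \<phi>') \<in> atlas \<Longrightarrow> y \<in> \<phi> ` (U \<inter> V) \<Longrightarrow>
         det (matrix (frechet_derivative (\<phi>' \<circ> inv_into U \<phi>) (at y))) > 0"
begin

definition smooth_map_on :: "'a set \<Rightarrow> ('a \<Rightarrow> 'w::real_normed_vector) \<Rightarrow> bool" where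
  "smooth_map_on W f \<longleftrightarrow>
     (\<forall>(U, \<phi>)\<in>atlas. smooth_on (\<phi> ` (U \<inter> W)) (f \<circ> inv_into U \<phi>))"

definition smooth_near :: "'a \<Rightarrow> ('a \<Rightarrow> real) \<Rightarrow> bool" where
  "smooth_near x f \<longleftrightarrow> (\<exists>W. open W \<and> x \<in> W \<and> smooth_map_on W f)"

text \<open>
  Tangent vectors at \<open>x\<close> are directional derivatives acting on the real functions that are smooth
  near \<open>x\<close>. As HOL functions are total, they are given the value \<open>0\<close> on all other functions, so
  that equality of tangent vectors is equality of HOL functions. The vector
  \<open>coord_vec (U, \<phi>) x u\<close> is the one with components \<open>u\<close> in the chart \<open>\<phi>\<close>.
\<close>

definition coord_vec :: "('a, 'n) chart \<Rightarrow> 'a \<Rightarrow> real ^ 'n \<Rightarrow> ('a \<Rightarrow> real) \<Rightarrow> real" where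
  "coord_vec c x u f =
     (if smooth_near x f
      then frechet_derivative (f \<circ> inv_into (fst c) (snd c)) (at (snd c x)) u
      else 0)"

definition tangent_space :: "'a \<Rightarrow> (('a \<Rightarrow> real) \<Rightarrow> real) set" where
  "tangent_space x = {coord_vec c x u |c u. c \<in> atlas \<and> x \<in> fst c}"

end


section \<open>Riemannian manifolds\<close>

text \<open>\<open>g x\<close> is only meaningful on \<open>tangent_space x\<close>.\<close>

locale oriented_riemannian_manifold = oriented_manifold atlas
  for atlas :: "('a::{t2_space, second_countable_topology}, 'n::finite) chart set" +
  fixes g :: "'a \<Rightarrow> (('a \<Rightarrow> real) \<Rightarrow> real) \<Rightarrow> (('a \<Rightarrow> real) \<Rightarrow> real) \<Rightarrow> real"
  assumes g_linear:
      "v \<in> tangent_space x \<Longrightarrow> w \<in> tangent_space x \<Longrightarrow> z \<in> tangent_space x \<Longrightarrow>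
         g x (\<lambda>f. a * v f + b * w f) z = a * g x v z + b * g x w z"
    and g_sym: "v \<in> tangent_space x \<Longrightarrow> w \<in> tangent_space x \<Longrightarrow> g x v w = g x w v"
    and g_pos: "v \<in> tangent_space x \<Longrightarrow> v \<noteq> (\<lambda>f. 0) \<Longrightarrow> g x v v > 0"
    and g_smooth:
      "c \<in> atlas \<Longrightarrow> smooth_map_on (fst c) (\<lambda>x. g x (coord_vec c x u) (coord_vec c x u'))"
begin

definition gram :: "('a, 'n) chart \<Rightarrow> 'a \<Rightarrow> real ^ 'n ^ 'n" where
  "gram c x = (\<chi> i j. g x (coord_vec c x (axis i 1)) (coord_vec c x (axis j 1)))"

text \<open>
  The Riemannian volume: the unique Borel measure which in every chart has density
  \<open>sqrt (det (g\<^sub>i\<^sub>j))\<close> with respect to Lebesgue measure.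
\<close>

definition vol :: "'a measure" where
  "vol = (THE \<mu>. sets \<mu> = sets borel \<and>
     (\<forall>(U, \<phi>)\<in>atlas. \<forall>A\<in>sets borel. A \<subseteq> U \<longrightarrow>
        emeasure \<mu> A =
          (\<integral>\<^sup>+ y. ennreal (sqrt (det (gram (U, \<phi>) (inv_into U \<phi> y)))) * indicator (\<phi> ` A) y
             \<partial>lborel)))"

definition gradient :: "('a \<Rightarrow> real) \<Rightarrow> 'a \<Rightarrow> ('a \<Rightarrow> real) \<Rightarrow> real" where
  "gradient f x = (THE v. v \<in> tangent_space x \<and> (\<forall>w\<in>tangent_space x. g x v w = w f))"

definition orthonormal_frame_at :: "'a \<Rightarrow> ('n \<Rightarrow> ('a \<Rightarrow> real) \<Rightarrow> real) \<Rightarrow> bool" where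
  "orthonormal_frame_at x E \<longleftrightarrow>
     (\<forall>i. E i \<in> tangent_space x) \<and> (\<forall>i j. g x (E i) (E j) = (if i = j then 1 else 0))"

end


section \<open>Oriented Riemannian vector bundles with connection\<close>

text \<open>
  The total space is the type \<open>'e\<close>, with projection \<open>proj\<close> and fibrewise vector space operations
  \<open>add\<close> and \<open>scale\<close>; \<open>add\<close> is only meaningful on vectors of the same fibre. A local trivialisation
  is a pair \<open>(V, \<psi>)\<close> such that \<open>e \<mapsto> (proj e, \<psi> e)\<close> identifies the part of the bundle over \<open>V\<close> with
  \<open>V \<times> real ^ 'k\<close>. That the fibres are vector spaces follows from the trivialisations being
  fibrewise linear bijections. The topology and the smooth structure of the total space are those
  induced by the trivialisations, whose transition functions are smooth, and orientation-preserving
  on each fibre.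
\<close>

definition fibre_inv :: "('e \<Rightarrow> 'a) \<Rightarrow> ('e \<Rightarrow> real ^ 'k) \<Rightarrow> 'a \<Rightarrow> real ^ 'k \<Rightarrow> 'e" where
  "fibre_inv proj \<psi> x = inv_into (proj -` {x}) \<psi>"

locale oriented_vector_bundle = oriented_manifold atlas
  for atlas :: "('a::{t2_space, second_countable_topology}, 'n::finite) chart set" +
  fixes proj :: "'e \<Rightarrow> 'a"
    and add :: "'e \<Rightarrow> 'e \<Rightarrow> 'e"
    and scale :: "real \<Rightarrow> 'e \<Rightarrow> 'e"
    and triv :: "('a set \<times> ('e \<Rightarrow> real ^ 'k::finite)) set"
  assumes proj_add: "proj e = proj e' \<Longrightarrow> proj (add e e') = proj e"
    and proj_scale: "proj (scale r e) = proj e"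
    and triv_open: "(V, \<psi>) \<in> triv \<Longrightarrow> open V"
    and triv_cover: "\<exists>(V, \<psi>)\<in>triv. x \<in> V"
    and triv_bij: "(V, \<psi>) \<in> triv \<Longrightarrow> x \<in> V \<Longrightarrow> bij_betw \<psi> (proj -` {x}) UNIV"
    and triv_add:
      "(V, \<psi>) \<in> triv \<Longrightarrow> proj e \<in> V \<Longrightarrow> proj e' = proj e \<Longrightarrow> \<psi> (add e e') = \<psi> e + \<psi> e'"
    and triv_scale: "(V, \<psi>) \<in> triv \<Longrightarrow> proj e \<in> V \<Longrightarrow> \<psi> (scale r e) = r *\<^sub>R \<psi> e"
    and triv_change_smooth:
      "(V, \<psi>) \<in> triv \<Longrightarrow> (V', \<psi>') \<in> triv \<Longrightarrow>
         smooth_map_on (V \<inter> V') (\<lambda>x. \<psi>' (fibre_inv proj \<psi> x y))"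
    and triv_change_oriented:
      "(V, \<psi>) \<in> triv \<Longrightarrow> (V', \<psi>') \<in> triv \<Longrightarrow> x \<in> V \<inter> V' \<Longrightarrow>
         det (matrix (\<lambda>y. \<psi>' (fibre_inv proj \<psi> x y))) > 0"
begin

definition smooth_section :: "('a \<Rightarrow> 'e) \<Rightarrow> bool" where
  "smooth_section \<sigma> \<longleftrightarrow>
     (\<forall>x. proj (\<sigma> x) = x) \<and> (\<forall>(V, \<psi>)\<in>triv. smooth_map_on V (\<lambda>x. \<psi> (\<sigma> x)))"

text \<open>
  \<open>S\<close> is a smooth map \<open>(-\<epsilon>, \<epsilon>) \<times> M \<rightarrow> \<E>\<close>, written in local coordinates, each \<open>S t\<close> is a section,
  and \<open>S 0 = \<sigma>\<close>.
\<close>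

definition smooth_variation :: "('a \<Rightarrow> 'e) \<Rightarrow> real \<Rightarrow> (real \<Rightarrow> 'a \<Rightarrow> 'e) \<Rightarrow> bool" where
  "smooth_variation \<sigma> \<epsilon> S \<longleftrightarrow>
     \<epsilon> > 0 \<and> S 0 = \<sigma> \<and>
     (\<forall>t\<in>{-\<epsilon><..<\<epsilon>}. \<forall>x. proj (S t x) = x) \<and>
     (\<forall>(U, \<phi>)\<in>atlas. \<forall>(V, \<psi>)\<in>triv.
        smooth_on ({-\<epsilon><..<\<epsilon>} \<times> \<phi> ` (U \<inter> V)) (\<lambda>(t, y). \<psi> (S t (inv_into U \<phi> y))))"

end

text \<open>
  \<open>fm\<close> is the fibre metric, only meaningful on vectors of the same fibre. \<open>D x v \<sigma>\<close> is the covariant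
  derivative of the smooth section \<open>\<sigma>\<close> along the tangent vector \<open>v\<close> at \<open>x\<close>. Thus \<open>v \<mapsto> D x v \<sigma>\<close> is a
  1-form with values in the bundle, and \<open>connection_smooth\<close> says that this 1-form is smooth.
\<close>

locale riemannian_vector_bundle_with_connection =
  oriented_riemannian_manifold atlas g + oriented_vector_bundle atlas proj add scale triv
  for atlas :: "('a::{t2_space, second_countable_topology}, 'n::finite) chart set"
    and g :: "'a \<Rightarrow> (('a \<Rightarrow> real) \<Rightarrow> real) \<Rightarrow> (('a \<Rightarrow> real) \<Rightarrow> real) \<Rightarrow> real"
    and proj :: "'e \<Rightarrow> 'a"
    and add :: "'e \<Rightarrow> 'e \<Rightarrow> 'e"
    and scale :: "real \<Rightarrow> 'e \<Rightarrow> 'e"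
    and triv :: "('a set \<times> ('e \<Rightarrow> real ^ 'k::finite)) set" +
  fixes fm :: "'e \<Rightarrow> 'e \<Rightarrow> real"
    and D :: "'a \<Rightarrow> (('a \<Rightarrow> real) \<Rightarrow> real) \<Rightarrow> ('a \<Rightarrow> 'e) \<Rightarrow> 'e"
  assumes fm_linear:
      "proj e = proj e'' \<Longrightarrow> proj e' = proj e'' \<Longrightarrow>
         fm (add (scale a e) (scale b e')) e'' = a * fm e e'' + b * fm e' e''"
    and fm_sym: "proj e = proj e' \<Longrightarrow> fm e e' = fm e' e"
    and fm_pos: "e \<noteq> scale 0 e \<Longrightarrow> fm e e > 0"
    and fm_smooth:
      "(V, \<psi>) \<in> triv \<Longrightarrow>
         smooth_map_on V (\<lambda>x. fm (fibre_inv proj \<psi> x y) (fibre_inv proj \<psi> x z))"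
    and connection_fibre:
      "smooth_section \<sigma> \<Longrightarrow> v \<in> tangent_space x \<Longrightarrow> proj (D x v \<sigma>) = x"
    and connection_linear:
      "smooth_section \<sigma> \<Longrightarrow> v \<in> tangent_space x \<Longrightarrow> w \<in> tangent_space x \<Longrightarrow>
         D x (\<lambda>f. a * v f + b * w f) \<sigma> = add (scale a (D x v \<sigma>)) (scale b (D x w \<sigma>))"
    and connection_smooth:
      "smooth_section \<sigma> \<Longrightarrow> c \<in> atlas \<Longrightarrow> (V, \<psi>) \<in> triv \<Longrightarrow>
         smooth_map_on (fst c \<inter> V) (\<lambda>x. \<psi> (D x (coord_vec c x u) \<sigma>))"
    and connection_add:
      "smooth_section \<sigma> \<Longrightarrow> smooth_section \<tau> \<Longrightarrow> v \<in> tangent_space x \<Longrightarrow>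
         D x v (\<lambda>y. add (\<sigma> y) (\<tau> y)) = add (D x v \<sigma>) (D x v \<tau>)"
    and connection_leibniz:
      "smooth_section \<sigma> \<Longrightarrow> smooth_map_on UNIV f \<Longrightarrow> v \<in> tangent_space x \<Longrightarrow>
         D x v (\<lambda>y. scale (f y) (\<sigma> y)) = add (scale (v f) (\<sigma> x)) (scale (f x) (D x v \<sigma>))"
    and connection_metric:
      "smooth_section \<sigma> \<Longrightarrow> smooth_section \<tau> \<Longrightarrow> v \<in> tangent_space x \<Longrightarrow>
         v (\<lambda>y. fm (\<sigma> y) (\<tau> y)) = fm (D x v \<sigma>) (\<tau> x) + fm (\<sigma> x) (D x v \<tau>)"
begin

definition fibre_norm :: "'e \<Rightarrow> real" where
  "fibre_norm e = sqrt (fm e e)"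

definition half_square_length :: "('a \<Rightarrow> 'e) \<Rightarrow> 'a \<Rightarrow> real" where
  "half_square_length \<sigma> x = (fibre_norm (\<sigma> x))\<^sup>2 / 2"

text \<open>The sum does not depend on the orthonormal frame, so it does not matter which one is chosen.\<close>

definition deriv_norm_sq :: "('a \<Rightarrow> 'e) \<Rightarrow> 'a \<Rightarrow> real" where
  "deriv_norm_sq \<sigma> x =
     (let E = (SOME E. orthonormal_frame_at x E)
      in \<Sum>i\<in>UNIV. (fibre_norm (D x (E i) \<sigma>))\<^sup>2)"

definition grad_norm_sq :: "('a \<Rightarrow> real) \<Rightarrow> 'a \<Rightarrow> real" where
  "grad_norm_sq f x = g x (gradient f x) (gradient f x)"

definition vertical_energy :: "real \<Rightarrow> real \<Rightarrow> ('a \<Rightarrow> 'e) \<Rightarrow> real" where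
  "vertical_energy p q \<sigma> =
     1 / 2 * (\<integral>x. 1 / (1 + (fibre_norm (\<sigma> x))\<^sup>2) powr p *
                  (deriv_norm_sq \<sigma> x + q * grad_norm_sq (half_square_length \<sigma>) x) \<partial>vol)"

definition harmonic_section :: "real \<Rightarrow> real \<Rightarrow> ('a \<Rightarrow> 'e) \<Rightarrow> bool" where
  "harmonic_section p q \<sigma> \<longleftrightarrow>
     smooth_section \<sigma> \<and>
     (\<forall>\<epsilon> S. smooth_variation \<sigma> \<epsilon> S \<longrightarrow>
        ((\<lambda>t. vertical_energy p q (S t)) has_real_derivative 0) (at 0))"

end

end

theory Submission
  imports Defs
begin

text \<open>
  The energy is affine in \<open>q\<close>. If a section \<open>\<sigma>\<close> is harmonic for two values of \<open>q\<close>, then the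
  coefficient of \<open>q\<close>, which is half the integral of \<open>(1 + 2F)\<^sup>-\<^sup>p |\<nabla>F|\<^sup>2\<close> with \<open>F = |\<sigma>|\<^sup>2 / 2\<close>, is
  stationary at \<open>\<sigma>\<close> along every variation. Along \<open>\<sigma>\<^sub>t = (1 + t (1 + 2F)\<^sup>m) \<sigma>\<close> with a natural number
  \<open>m \<ge> |p|\<close> the function \<open>F\<^sub>t\<close> is an increasing function of \<open>F\<close>, and an elementary inequality shows
  that the integrand at time \<open>t\<close> is at least \<open>1 + t\<close> times the integrand at time \<open>0\<close>, for all small
  \<open>t \<ge> 0\<close>. Stationarity thus forces the integral to vanish. As the volume charges every nonempty
  open set, \<open>\<nabla>F = 0\<close>, and \<open>F\<close> is constant by connectedness.

  Since the volume is specified by a definite description, its existence is proved as well: the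
  chart measures agree on overlaps by the change of variables formula, and by compactness finitely
  many of them can be glued along a Borel partition.
\<close>

section \<open>Calculus of smooth maps\<close>

text \<open>The plain dilation \<open>(1 + t) \<sigma>\<close> would not do: it multiplies
  |\<nabla>F|^2 by \<open>(1 + t) ^ 4\<close>, but for large \<open>p\<close> the weight can shrink
  faster wherever |\<sigma>| is large. A factor that grows with F cures this. Put z = 2F / (1 + 2F),
  a number in [0, 1). At t = 0 the relative growth rate of the integrand is (1 + 2F)^m (4 + 4 m z -
  2 p z), where 4 m z is the extra stretching caused by the non-uniform factor and -2 p z is the
  loss in the weight. With m \<ge> |p| this is at least 4, which leaves room for the second-order
  terms above the modest rate 1 that is claimed. A natural exponent makes the factor a polynomial in
  F, so its smoothness needs only sums and products.

  The comparison is pointwise and one-sided. It replaces the first variation formula, so nothing is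
  differentiated under the integral sign: right difference quotients alone bound the integral from
  above by 0. Compactness bounds (1 + 2F)^m and so provides one range of t for all points.\<close>

lemma Ck_on_subset: "Ck_on k S f \<Longrightarrow> T \<subseteq> S \<Longrightarrow> Ck_on k T f"
  by (induction k arbitrary: f) (auto intro: continuous_on_subset)

text \<open>Both functions have the same derivatives at \<open>x\<close>, so the choice operator
  inside \<open>frechet_derivative\<close> is applied to the same predicate. The equality thus also
  covers points without a derivative.\<close>

lemma frechet_derivative_cong_open:
  assumes "open S" "x \<in> S" "\<And>y. y \<in> S \<Longrightarrow> f y = g y"
  shows "frechet_derivative f (at x) = frechet_derivative g (at x)"
proof -
  have "(f has_derivative D) (at x) \<longleftrightarrow> (g has_derivative D) (at x)" for D
    by (intro iffI; erule has_derivative_transform_within_open[OF _ assms(1,2)]) (simp_all add: assms(3))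
  then show ?thesis by (simp add: frechet_derivative_def)
qed

lemma differentiable_cong_open:
  assumes "open S" "x \<in> S" "\<And>y. y \<in> S \<Longrightarrow> f y = g y" "f differentiable (at x)"
  shows "g differentiable (at x)"
proof -
  obtain D where "(f has_derivative D) (at x)"
    using assms(4) unfolding differentiable_def by blast
  then have "(g has_derivative D) (at x)"
    by (rule has_derivative_transform_within_open[OF _ assms(1-3)])
  then show ?thesis by (rule differentiableI)
qed

lemma Ck_on_cong:
  assumes "open S" "\<And>y. y \<in> S \<Longrightarrow> f y = g y" "Ck_on k S f"
  shows "Ck_on k S g"
  using assms(2,3)
proof (induction k arbitrary: f g)
  case 0
  then show ?case by (simp cong: continuous_on_cong)
next
  case (Suc k)
  have "Ck_on k S (\<lambda>x. frechet_derivative g (at x) v)" for v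
  proof (rule Suc.IH)
    show "Ck_on k S (\<lambda>x. frechet_derivative f (at x) v)"
      using Suc.prems(2) by simp
    show "frechet_derivative f (at x) v = frechet_derivative g (at x) v" if "x \<in> S" for x
      using frechet_derivative_cong_open[OF assms(1) that Suc.prems(1)] by simp
  qed
  moreover have "\<forall>x\<in>S. g differentiable (at x)"
    using Suc.prems(2) differentiable_cong_open[OF assms(1) _ Suc.prems(1)] by simp
  ultimately show ?case by simp
qed

lemma Ck_on_SucD: "Ck_on (Suc k) S f \<Longrightarrow> x \<in> S \<Longrightarrow> (f has_derivative frechet_derivative f (at x)) (at x)"
  "Ck_on (Suc k) S f \<Longrightarrow> Ck_on k S (\<lambda>x. frechet_derivative f (at x) v)"
  by (simp_all add: frechet_derivative_works[symmetric])

text \<open>At successor orders \<open>Ck_on\<close> speaks only of derivatives, so lower orders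
  have to be recovered by induction. The base case is continuity of differentiable
  functions.\<close>

lemma Ck_on_Suc_imp: "Ck_on (Suc k) S f \<Longrightarrow> Ck_on k S f"
proof (induction k arbitrary: f)
  case 0
  then show ?case
    by (simp add: continuous_at_imp_continuous_on differentiable_imp_continuous_within)
next
  case (Suc k)
  show ?case
    unfolding Ck_on.simps(2)[of k]
  proof (intro conjI allI)
    show "\<forall>x\<in>S. f differentiable (at x)"
      using Suc.prems by simp
    show "Ck_on k S (\<lambda>x. frechet_derivative f (at x) v)" for v
      by (rule Suc.IH[OF Ck_on_SucD(2)[OF Suc.prems]])
  qed
qed

lemma Ck_on_local:
  assumes "\<And>x. x \<in> S \<Longrightarrow> \<exists>T. open T \<and> x \<in> T \<and> Ck_on k T f"
  shows "Ck_on k S f"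
  using assms
proof (induction k arbitrary: f)
  case 0
  have "isCont f x" if "x \<in> S" for x
    using 0[OF that] by (auto simp: continuous_on_eq_continuous_at)
  then show ?case
    by (simp add: continuous_at_imp_continuous_on)
next
  case (Suc k)
  have "\<forall>x\<in>S. f differentiable (at x)"
    using Suc.prems by fastforce
  moreover have "Ck_on k S (\<lambda>x. frechet_derivative f (at x) v)" for v
    by (rule Suc.IH) (use Suc.prems in fastforce)
  ultimately show ?case by simp
qed

text \<open>Closure proofs obtain an explicit derivative from the usual rules. Uniqueness of
  derivatives identifies it on \<open>S\<close> with \<open>frechet_derivative\<close>, the only one
  that the definition mentions.\<close>

lemma Ck_on_SucI:
  assumes "open S" and D: "\<And>x. x \<in> S \<Longrightarrow> (f has_derivative f' x) (at x)"
    and C: "\<And>v. Ck_on k S (\<lambda>x. f' x v)"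
  shows "Ck_on (Suc k) S f"
proof -
  have "f' x v = frechet_derivative f (at x) v" if "x \<in> S" for x v
    using frechet_derivative_at[OF D[OF that]] by simp
  then have "Ck_on k S (\<lambda>x. frechet_derivative f (at x) v)" for v
    by (intro Ck_on_cong[OF \<open>open S\<close> _ C[of v]])
  moreover have "f differentiable (at x)" if "x \<in> S" for x
    using D[OF that] by (rule differentiableI)
  ultimately show ?thesis by simp
qed

lemma Ck_on_const: "Ck_on k S (\<lambda>x. c)"
  by (induction k arbitrary: c) (simp_all add: frechet_derivative_const)

lemma Ck_on_bounded_linear:
  assumes "bounded_linear f"
  shows "Ck_on k S f"
proof (cases k)
  case 0
  then show ?thesis using assms by (simp add: linear_continuous_on)
next
  case (Suc j)
  have "Ck_on (Suc j) UNIV f"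
    by (rule Ck_on_SucI[OF open_UNIV bounded_linear_imp_has_derivative[OF assms] Ck_on_const])
  then show ?thesis unfolding Suc by (rule Ck_on_subset) simp
qed

lemma Ck_on_add:
  assumes "open S"
  shows "Ck_on k S f \<Longrightarrow> Ck_on k S g \<Longrightarrow> Ck_on k S (\<lambda>x. f x + g x)"
proof (induction k arbitrary: f g)
  case 0
  then show ?case by (simp add: continuous_on_add)
next
  case (Suc k)
  show ?case
    by (rule Ck_on_SucI[OF assms has_derivative_add[OF Ck_on_SucD(1) Ck_on_SucD(1)]
        Suc.IH[OF Ck_on_SucD(2) Ck_on_SucD(2)]]) (rule Suc.prems | assumption)+
qed

text \<open>The product rule yields two bilinear terms, each pairing a derivative with an
  undifferentiated factor, and \<open>Ck_on_Suc_imp\<close> lowers the latter to order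
  \<open>k\<close>.\<close>

lemma Ck_on_bilinear:
  fixes B :: "'a::real_normed_vector \<Rightarrow> 'b::real_normed_vector \<Rightarrow> 'c::real_normed_vector"
  assumes "open S" and B: "bounded_bilinear B"
  shows "Ck_on k S f \<Longrightarrow> Ck_on k S g \<Longrightarrow> Ck_on k S (\<lambda>x. B (f x) (g x))"
proof (induction k arbitrary: f g)
  case 0
  then show ?case by (simp add: bounded_bilinear.continuous_on[OF B])
next
  case (Suc k)
  show ?case
    by (rule Ck_on_SucI[OF assms(1) bounded_bilinear.FDERIV[OF B Ck_on_SucD(1) Ck_on_SucD(1)]
        Ck_on_add[OF assms(1) Suc.IH[OF Ck_on_Suc_imp Ck_on_SucD(2)] Suc.IH[OF Ck_on_SucD(2) Ck_on_Suc_imp]]])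
      (rule Suc.prems | assumption)+
qed

lemma Ck_on_linear_comp:
  assumes "open S" and L: "bounded_linear L"
  shows "Ck_on k S f \<Longrightarrow> Ck_on k S (\<lambda>x. L (f x))"
proof (induction k arbitrary: f)
  case 0
  then show ?case by (simp add: bounded_linear.continuous_on[OF L])
next
  case (Suc k)
  show ?case
    by (rule Ck_on_SucI[OF assms(1) bounded_linear.has_derivative[OF L Ck_on_SucD(1)]
        Suc.IH[OF Ck_on_SucD(2)]]) (rule Suc.prems | assumption)+
qed

text \<open>A linear inner map has constant derivative, so the composite differentiated along
  \<open>v\<close> is the derivative of \<open>f\<close> along the fixed vector \<open>L v\<close>,
  composed with \<open>L\<close> again. This lets functions of the point be read as functions of
  time and point.\<close>

lemma Ck_on_comp_linear:
  assumes "open S" and L: "bounded_linear L" and "\<And>x. x \<in> S \<Longrightarrow> L x \<in> T"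
  shows "Ck_on k T f \<Longrightarrow> Ck_on k S (\<lambda>x. f (L x))"
proof (induction k arbitrary: f)
  case 0
  then show ?case
    using continuous_on_compose2[OF _ linear_continuous_on[OF L], of T f S] assms(3) by auto
next
  case (Suc k)
  show ?case
    by (rule Ck_on_SucI[OF assms(1) has_derivative_compose[OF bounded_linear_imp_has_derivative[OF L] Ck_on_SucD(1)[OF _ assms(3)]]
        Suc.IH[OF Ck_on_SucD(2)]]) (rule Suc.prems | assumption)+
qed

lemma smooth_on_cong: "open S \<Longrightarrow> (\<And>y. y \<in> S \<Longrightarrow> f y = g y) \<Longrightarrow> smooth_on S f \<Longrightarrow> smooth_on S g"
  unfolding smooth_on_def by (blast intro: Ck_on_cong)

lemma smooth_on_subset: "smooth_on S f \<Longrightarrow> T \<subseteq> S \<Longrightarrow> smooth_on T f"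
  unfolding smooth_on_def by (blast intro: Ck_on_subset)

lemma smooth_on_local:
  assumes "\<And>x. x \<in> S \<Longrightarrow> \<exists>T. open T \<and> x \<in> T \<and> smooth_on T f"
  shows "smooth_on S f"
  unfolding smooth_on_def
proof (intro allI Ck_on_local)
  show "\<exists>T. open T \<and> x \<in> T \<and> Ck_on k T f" if "x \<in> S" for k x
    using assms[OF that] unfolding smooth_on_def by blast
qed

lemma smooth_on_const: "smooth_on S (\<lambda>x. c)"
  by (simp add: smooth_on_def Ck_on_const)

lemma smooth_on_bounded_linear: "bounded_linear f \<Longrightarrow> smooth_on S f"
  by (simp add: smooth_on_def Ck_on_bounded_linear)

lemma smooth_on_add:
  "open S \<Longrightarrow> smooth_on S f \<Longrightarrow> smooth_on S g \<Longrightarrow> smooth_on S (\<lambda>x. f x + g x)"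
  by (simp add: smooth_on_def Ck_on_add)

lemma smooth_on_bilinear:
  "open S \<Longrightarrow> bounded_bilinear B \<Longrightarrow> smooth_on S f \<Longrightarrow> smooth_on S g \<Longrightarrow>
    smooth_on S (\<lambda>x. B (f x) (g x))"
  by (simp add: smooth_on_def Ck_on_bilinear)

lemmas smooth_on_mult = smooth_on_bilinear[OF _ bounded_bilinear_mult]
lemmas smooth_on_scaleR = smooth_on_bilinear[OF _ bounded_bilinear_scaleR]

lemma smooth_on_linear_comp:
  "open S \<Longrightarrow> bounded_linear L \<Longrightarrow> smooth_on S f \<Longrightarrow> smooth_on S (\<lambda>x. L (f x))"
  by (simp add: smooth_on_def Ck_on_linear_comp)

lemma smooth_on_comp_linear:
  assumes "open S" "bounded_linear L" "\<And>x. x \<in> S \<Longrightarrow> L x \<in> T" "smooth_on T f"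
  shows "smooth_on S (\<lambda>x. f (L x))"
  unfolding smooth_on_def
proof
  show "Ck_on k S (\<lambda>x. f (L x))" for k
    using assms(4) unfolding smooth_on_def by (intro Ck_on_comp_linear[OF assms(1-3)]) simp_all
qed

lemma smooth_on_sum:
  assumes "open S" "\<And>i. i \<in> I \<Longrightarrow> smooth_on S (f i)"
  shows "smooth_on S (\<lambda>x. \<Sum>i\<in>I. f i x)"
proof (cases "finite I")
  case True
  then show ?thesis using assms(2)
  proof (induction I)
    case (insert i I)
    then have "smooth_on S (\<lambda>x. f i x + (\<Sum>i\<in>I. f i x))"
      by (intro smooth_on_add[OF assms(1)]) simp_all
    then show ?case using insert.hyps by simp
  qed (simp add: smooth_on_const)
qed (simp add: smooth_on_const)

lemma smooth_on_power:
  fixes f :: "'v::real_normed_vector \<Rightarrow> real"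
  assumes "open S" "smooth_on S f"
  shows "smooth_on S (\<lambda>x. f x ^ n)"
proof (induction n)
  case (Suc n)
  show ?case using smooth_on_mult[OF assms Suc] by simp
qed (simp add: smooth_on_const)

lemma smooth_on_has_derivative:
  "smooth_on S f \<Longrightarrow> x \<in> S \<Longrightarrow> (f has_derivative frechet_derivative f (at x)) (at x)"
  unfolding smooth_on_def by (blast intro: Ck_on_SucD(1))

lemma smooth_on_continuous_on: "smooth_on S f \<Longrightarrow> continuous_on S f"
  unfolding smooth_on_def using Ck_on.simps(1) by blast

lemma smooth_on_frechet_derivative:
  "smooth_on S f \<Longrightarrow> smooth_on S (\<lambda>x. frechet_derivative f (at x) v)"
  unfolding smooth_on_def by (blast intro: Ck_on_SucD(2))


section \<open>Change of variables over an arbitrary finite index type\<close>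

text \<open>For nonnegative functions absolute integrability is integrability, so the substitution
  theorem for absolutely integrable functions transfers a finite value from either side to the
  other. If neither side is finite, both are infinite.\<close>

lemma nn_integral_change_of_variables_wellorder:
  fixes h :: "real^'m::{finite,wellorder} \<Rightarrow> real^'m::_" and f :: "real^'m::_ \<Rightarrow> real"
  assumes S: "S \<in> sets borel"
    and der: "\<And>x. x \<in> S \<Longrightarrow> (h has_derivative h' x) (at x within S)"
    and inj: "inj_on h S"
    and nonneg: "\<And>y. y \<in> h ` S \<Longrightarrow> 0 \<le> f y"
    and meas_f: "(\<lambda>y. indicator (h ` S) y * f y) \<in> borel_measurable borel"
    and meas_g: "(\<lambda>x. indicator S x * (\<bar>det (matrix (h' x))\<bar> * f (h x))) \<in> borel_measurable borel"
  shows "(\<integral>\<^sup>+y. ennreal (f y) * indicator (h ` S) y \<partial>lborel) =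
    (\<integral>\<^sup>+x. ennreal (\<bar>det (matrix (h' x))\<bar> * f (h x)) * indicator S x \<partial>lborel)" (is "?a = ?b")
proof -
  let ?g = "\<lambda>x. \<bar>det (matrix (h' x))\<bar> * f (h x)"
  have gnn: "0 \<le> ?g x" if "x \<in> S" for x using nonneg that by simp
  have S': "S \<in> sets lebesgue" using S by simp
  have key: "(?g has_integral r) S \<longleftrightarrow> (f has_integral r) (h ` S)" for r
  proof -
    \<comment> \<open>The substitution theorem concerns vector-valued functions, so \<open>f\<close>
      is wrapped as a vector of length one.\<close>
    have "?g absolutely_integrable_on S \<and> integral S ?g = r \<longleftrightarrow>
        f absolutely_integrable_on (h ` S) \<and> integral (h ` S) f = r"
      using has_absolute_integral_change_of_variables[OF S' der inj, of "\<lambda>x. vec (f x) :: real^1" "vec r"]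
      by (simp add: absolutely_integrable_on_1_iff integral_on_1_eq)
    moreover have "?g absolutely_integrable_on S \<longleftrightarrow> ?g integrable_on S"
      by (rule absolutely_integrable_on_iff_nonneg) (rule gnn)
    moreover have "f absolutely_integrable_on h ` S \<longleftrightarrow> f integrable_on h ` S"
      by (rule absolutely_integrable_on_iff_nonneg) (rule nonneg)
    ultimately show ?thesis by (simp add: has_integral_iff)
  qed
  have *: "(u has_integral r) T"
    if "(\<integral>\<^sup>+y. ennreal (u y) * indicator T y \<partial>lborel) = ennreal r" "0 \<le> r"
      "\<And>y. y \<in> T \<Longrightarrow> 0 \<le> u y" "(\<lambda>y. indicator T y * u y) \<in> borel_measurable borel"
    for u :: "real^'m::_ \<Rightarrow> real" and T r
  proof -
    have "(\<integral>\<^sup>+y. ennreal (indicator T y * u y) \<partial>lborel) = ennreal r"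
      unfolding that(1)[symmetric] by (intro nn_integral_cong) (auto simp: indicator_def)
    then have "((\<lambda>y. indicator T y * u y) has_integral r) UNIV"
      using that by (intro nn_integral_has_integral) (auto simp: indicator_def)
    then show ?thesis
      by (subst has_integral_restrict_UNIV[symmetric])
        (elim has_integral_eq[rotated], auto simp: indicator_def)
  qed
  show ?thesis
  proof (cases "?a < \<infinity>")
    case True
    then obtain r where r: "?a = ennreal r" "0 \<le> r" by (cases ?a) auto
    then have "(f has_integral r) (h ` S)" by (rule *) (use nonneg meas_f in auto)
    then have "(?g has_integral r) S" using key by simp
    then have "?b = ennreal r" by (intro nn_integral_has_integral_lebesgue' gnn)
    then show ?thesis using r by simp
  next
    case inf: False
    show ?thesis
    proof (cases "?b < \<infinity>")
      case True
      then obtain r where r: "?b = ennreal r" "0 \<le> r" by (cases ?b) auto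
      then have "(?g has_integral r) S" by (rule *) (use gnn meas_g in auto)
      then have "(f has_integral r) (h ` S)" using key by simp
      then have "?a = ennreal r" by (intro nn_integral_has_integral_lebesgue' nonneg)
      then show ?thesis using r by simp
    qed (use inf in \<open>simp add: not_less top.extremum_unique\<close>)
  qed
qed

text \<open>
  The change of variables theorem of the library needs a well-ordered index type, so vectors over
  an arbitrary finite index type \<open>'n\<close> are moved to vectors over an ordered copy of \<open>'n\<close>.
\<close>

typedef 'n ordered = "UNIV :: 'n set" by simp

lemma bij_Rep_ordered: "bij Rep_ordered"
  by (metis Abs_ordered_inverse Rep_ordered_inverse UNIV_I bijI')

instance ordered :: (finite) finite
  by standard (metis bij_Rep_ordered bij_betw_finite finite)

instantiation ordered :: (finite) wellorder
begin

definition "x \<le> y \<longleftrightarrow> to_nat_on UNIV (Rep_ordered x) \<le> to_nat_on UNIV (Rep_ordered y)"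
definition "x < y \<longleftrightarrow> to_nat_on UNIV (Rep_ordered x) < to_nat_on UNIV (Rep_ordered y)"

instance
proof
  fix x y z :: "'a ordered"
  show "(x < y) = (x \<le> y \<and> \<not> y \<le> x)" by (auto simp: less_eq_ordered_def less_ordered_def)
  show "x \<le> x" by (simp add: less_eq_ordered_def)
  show "x \<le> y \<Longrightarrow> y \<le> z \<Longrightarrow> x \<le> z" by (simp add: less_eq_ordered_def)
  show "x \<le> y \<or> y \<le> x" by (auto simp: less_eq_ordered_def)
  have "inj (to_nat_on (UNIV :: 'a set))"
    by (rule inj_on_to_nat_on) (simp add: countable_finite)
  then show "x \<le> y \<Longrightarrow> y \<le> x \<Longrightarrow> x = y"
    by (simp add: less_eq_ordered_def Rep_ordered_inject inj_eq)
next
  fix P :: "'a ordered \<Rightarrow> bool" and a :: "'a ordered"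
  assume IH: "\<And>x. (\<And>y. y < x \<Longrightarrow> P y) \<Longrightarrow> P x"
  show "P a"
    by (induction a rule: measure_induct_rule[of "\<lambda>x. to_nat_on UNIV (Rep_ordered x)"])
      (rule IH, simp add: less_ordered_def)
qed

end

definition to_ordered :: "real^'n \<Rightarrow> real^'n ordered" where
  "to_ordered x = (\<chi> i. x $ Rep_ordered i)"

definition of_ordered :: "real^'n ordered \<Rightarrow> real^'n" where
  "of_ordered x = (\<chi> i. x $ Abs_ordered i)"

lemma of_to_ordered [simp]: "of_ordered (to_ordered x) = x" "to_ordered (of_ordered z) = z"
  by (simp_all add: of_ordered_def to_ordered_def vec_eq_iff Abs_ordered_inverse Rep_ordered_inverse)

lemma bounded_linear_ordered: "bounded_linear to_ordered" "bounded_linear of_ordered"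
  by (auto simp: linear_conv_bounded_linear[symmetric] to_ordered_def of_ordered_def vec_eq_iff intro!: linearI)

text \<open>Relabelling coordinates carries boxes to boxes with the same side lengths, and Lebesgue
  measure is determined by its values on boxes.\<close>

lemma lborel_of_ordered: "distr lborel borel of_ordered = (lborel :: (real^'n::finite) measure)"
proof (rule lborel_eqI[symmetric])
  have [measurable]: "(of_ordered :: real^'n ordered \<Rightarrow> real^'n) \<in> borel_measurable borel"
    by (intro borel_measurable_continuous_onI linear_continuous_on bounded_linear_ordered)
  fix l u :: "real^'n"
  assume lu: "\<And>b. b \<in> Basis \<Longrightarrow> l \<bullet> b \<le> u \<bullet> b"
  have "of_ordered -` box l u = box (to_ordered l) (to_ordered u)"
    by (auto simp: mem_box_cart to_ordered_def of_ordered_def)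
      (metis Rep_ordered_inverse, metis Rep_ordered_inverse, (metis Abs_ordered_inverse UNIV_I)+)
  then have "emeasure (distr lborel borel of_ordered) (box l u)
      = emeasure lborel (box (to_ordered l) (to_ordered u))"
    by (simp add: emeasure_distr)
  also have "\<dots> = (\<Prod>b\<in>Basis. (to_ordered u - to_ordered l) \<bullet> b)"
  proof (rule emeasure_lborel_box)
    have "l $ i \<le> u $ i" for i
      using lu[of "axis i 1"] by (simp add: inner_axis)
    then show "to_ordered l \<bullet> b \<le> to_ordered u \<bullet> b" if "b \<in> Basis" for b
      using that by (auto simp: Basis_vec_def inner_axis to_ordered_def)
  qed
  \<comment> \<open>The basis vectors are the \<open>axis i 1\<close>; the choice operator recovers
    the index from the vector.\<close>
  also have "(\<Prod>b\<in>Basis. (to_ordered u - to_ordered l) \<bullet> b) = (\<Prod>i\<in>UNIV. (to_ordered u - to_ordered l) $ i)"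
    by (rule prod.reindex_bij_witness[of _ "\<lambda>i. axis i 1" "\<lambda>b. SOME i. b = axis i 1"])
      (auto simp: Basis_vec_def inner_axis axis_eq_axis)
  also have "\<dots> = (\<Prod>i\<in>UNIV. (u - l) $ i)"
    by (rule prod.reindex_bij_witness[of _ Abs_ordered Rep_ordered])
      (auto simp: to_ordered_def Rep_ordered_inverse Abs_ordered_inverse)
  also have "\<dots> = (\<Prod>b\<in>Basis. (u - l) \<bullet> b)"
    by (rule prod.reindex_bij_witness[of _ "\<lambda>b. SOME i. b = axis i 1" "\<lambda>i. axis i 1"])
      (auto simp: Basis_vec_def inner_axis axis_eq_axis)
  finally show "emeasure (distr lborel borel of_ordered) (box l u) = (\<Prod>b\<in>Basis. (u - l) \<bullet> b)" .
qed simp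

text \<open>Conjugation by \<open>r\<close> is a sign-preserving bijection between the permutations
  of the two index types, and it matches the terms of the two Leibniz sums.\<close>

lemma det_reindex:
  fixes A :: "real^'n::finite^'n" and r :: "'m::finite \<Rightarrow> 'n"
  assumes r: "bij r"
  shows "det (\<chi> i j. A $ r i $ r j) = det A"
proof -
  let ?r' = "inv r"
  have r': "bij ?r'" using r by (rule bij_imp_bij_inv)
  have [simp]: "?r' (r i) = i" "r (?r' j) = j" for i j
    using r by (simp_all add: bij_is_inj bij_is_surj surj_f_inv_f)
  have mp: "map_permutation UNIV f p x = f (p (inv f x))" if "bij f" for f :: "'c \<Rightarrow> 'd" and p x
    using that by (simp add: map_permutation_def restrict_id_def bij_is_surj)
  have ii: "inv ?r' = r" using r by (rule inv_inv_eq)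
  show ?thesis
    unfolding det_def
  proof (rule sum.reindex_bij_witness[of _ "map_permutation UNIV ?r'" "map_permutation UNIV r"])
    fix p assume p: "p \<in> {p. p permutes (UNIV :: 'm set)}"
    show "map_permutation UNIV ?r' (map_permutation UNIV r p) = p"
      by (rule ext) (simp add: mp[OF r] mp[OF r'] ii)
    show "map_permutation UNIV r p \<in> {p. p permutes UNIV}"
      using map_permutation_permutes[of r UNIV UNIV p] r p by simp
    have "sign (map_permutation UNIV r p) = sign p"
      using r p by (intro sign_map_permutation) (simp_all add: bij_is_inj)
    moreover have "(\<Prod>i\<in>UNIV. A $ i $ map_permutation UNIV r p i) = (\<Prod>i\<in>UNIV. A $ r i $ r (p i))"
      by (rule prod.reindex_bij_witness[of _ r ?r']) (simp_all add: mp[OF r])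
    ultimately show "of_int (sign (map_permutation UNIV r p)) * (\<Prod>i\<in>UNIV. A $ i $ map_permutation UNIV r p i)
        = of_int (sign p) * (\<Prod>i\<in>UNIV. (\<chi> i j. A $ r i $ r j) $ i $ p i)" by simp
  next
    fix p assume p: "p \<in> {p. p permutes (UNIV :: 'n set)}"
    show "map_permutation UNIV r (map_permutation UNIV ?r' p) = p"
      by (rule ext) (simp add: mp[OF r] mp[OF r'] ii)
    show "map_permutation UNIV ?r' p \<in> {p. p permutes UNIV}"
      using map_permutation_permutes[of ?r' UNIV UNIV p] r' p by simp
  qed
qed

text \<open>Conjugating \<open>h\<close> with the relabelling permutes rows and columns of its
  derivative matrix in the same way, so the determinant survives by \<open>det_reindex\<close>;
  \<open>lborel_of_ordered\<close> moves both integrals.\<close>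

lemma nn_integral_change_of_variables:
  fixes h :: "real^'n::finite \<Rightarrow> real^'n" and f :: "real^'n \<Rightarrow> real"
  assumes S: "S \<in> sets borel"
    and der: "\<And>x. x \<in> S \<Longrightarrow> (h has_derivative h' x) (at x within S)"
    and inj: "inj_on h S"
    and nonneg: "\<And>y. y \<in> h ` S \<Longrightarrow> 0 \<le> f y"
    and meas_f [measurable]: "(\<lambda>y. indicator (h ` S) y * f y) \<in> borel_measurable borel"
    and meas_g [measurable]: "(\<lambda>x. indicator S x * (\<bar>det (matrix (h' x))\<bar> * f (h x))) \<in> borel_measurable borel"
  shows "(\<integral>\<^sup>+y. ennreal (f y) * indicator (h ` S) y \<partial>lborel) =
    (\<integral>\<^sup>+x. ennreal (\<bar>det (matrix (h' x))\<bar> * f (h x)) * indicator S x \<partial>lborel)"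
proof -
  let ?T = "to_ordered ` S" and ?k = "\<lambda>z. to_ordered (h (of_ordered z))"
  let ?k' = "\<lambda>z w. to_ordered (h' (of_ordered z) (of_ordered w))"
  have of_m [measurable]: "(of_ordered :: real^'n ordered \<Rightarrow> real^'n) \<in> borel_measurable borel"
    by (intro borel_measurable_continuous_onI linear_continuous_on bounded_linear_ordered)
  have T: "?T = of_ordered -` S" by (auto intro: image_eqI[of _ _ "of_ordered _"])
  have kT: "?k ` ?T = of_ordered -` (h ` S)"
  proof -
    have "z \<in> ?k ` ?T" if "of_ordered z = h x" "x \<in> S" for z x
    proof (rule image_eqI[of _ _ "to_ordered x"])
      show "z = ?k (to_ordered x)" using that(1) by (metis of_to_ordered)
    qed (use that in simp)
    then show ?thesis by auto
  qed
  have det: "det (matrix (?k' z)) = det (matrix (h' (of_ordered z)))" for z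
  proof -
    have "matrix (?k' z) = (\<chi> i j. matrix (h' (of_ordered z)) $ Rep_ordered i $ Rep_ordered j)"
    proof -
      have "of_ordered (axis j 1) = axis (Rep_ordered j) 1" for j :: "'n ordered"
        by (auto simp: of_ordered_def vec_eq_iff axis_def Rep_ordered_inverse Abs_ordered_inverse)
      then show ?thesis by (simp add: matrix_def to_ordered_def)
    qed
    then show ?thesis using det_reindex[OF bij_Rep_ordered] by simp
  qed
  have tr: "(\<integral>\<^sup>+x. F x \<partial>lborel) = (\<integral>\<^sup>+z. F (of_ordered z) \<partial>lborel)"
    if [measurable]: "F \<in> borel_measurable borel" for F :: "real^'n \<Rightarrow> ennreal"
    by (subst lborel_of_ordered[symmetric], subst nn_integral_distr) simp_all
  have e: "(\<lambda>x. ennreal (u x) * indicator A x) = (\<lambda>x. ennreal (indicator A x * u x))"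
    for u :: "real^'n \<Rightarrow> real" and A by (auto simp: indicator_def)
  have "(\<integral>\<^sup>+y. ennreal (f y) * indicator (h ` S) y \<partial>lborel)
      = (\<integral>\<^sup>+z. ennreal (f (of_ordered z)) * indicator (?k ` ?T) z \<partial>lborel)"
    by (subst tr) (simp_all add: e kT indicator_vimage)
  also have "\<dots> = (\<integral>\<^sup>+z. ennreal (\<bar>det (matrix (?k' z))\<bar> * f (of_ordered (?k z))) * indicator ?T z \<partial>lborel)"
  proof (rule nn_integral_change_of_variables_wellorder)
    show "?T \<in> sets borel" unfolding T using measurable_sets[OF of_m S] by simp
    show "(?k has_derivative ?k' z) (at z within ?T)" if "z \<in> ?T" for z
    proof (rule bounded_linear.has_derivative[OF bounded_linear_ordered(1)])
      have i: "of_ordered ` ?T = S" by (auto simp: image_image)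
      show "((\<lambda>z. h (of_ordered z)) has_derivative (\<lambda>w. h' (of_ordered z) (of_ordered w))) (at z within ?T)"
        using has_derivative_in_compose[of of_ordered of_ordered z ?T h "h' (of_ordered z)"]
          bounded_linear_imp_has_derivative[OF bounded_linear_ordered(2), of "at z within ?T"] der[of "of_ordered z"] that
        unfolding i T by (simp add: surjI[of of_ordered to_ordered])
    qed
    show "inj_on ?k ?T"
      using inj by (auto simp: inj_on_def) (metis of_to_ordered(1))
    show "0 \<le> f (of_ordered z)" if "z \<in> ?k ` ?T" for z using nonneg that by auto
    show "(\<lambda>y. indicator (?k ` ?T) y * f (of_ordered y)) \<in> borel_measurable borel"
      using measurable_compose[OF of_m meas_f] unfolding kT by (simp add: indicator_vimage)
    show "(\<lambda>z. indicator ?T z * (\<bar>det (matrix (?k' z))\<bar> * f (of_ordered (?k z)))) \<in> borel_measurable borel"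
      using measurable_compose[OF of_m meas_g] unfolding T det by (simp add: indicator_vimage)
  qed
  also have "\<dots> = (\<integral>\<^sup>+x. ennreal (\<bar>det (matrix (h' x))\<bar> * f (h x)) * indicator S x \<partial>lborel)"
    using tr[of "\<lambda>x. ennreal (\<bar>det (matrix (h' x))\<bar> * f (h x)) * indicator S x"]
    unfolding det T by (simp add: e indicator_vimage)
  finally show ?thesis .
qed


section \<open>Positive definite matrices\<close>

lemma inner_matrix_vector_sum:
  fixes G :: "real^'n^'n"
  shows "u \<bullet> (G *v v) = (\<Sum>i\<in>UNIV. \<Sum>j\<in>UNIV. u $ i * v $ j * G $ i $ j)"
  by (simp add: inner_vec_def matrix_vector_mult_def sum_distrib_left mult_ac)

definition posdef :: "real^'n^'n \<Rightarrow> bool" where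
  "posdef G \<longleftrightarrow> transpose G = G \<and> (\<forall>u. u \<noteq> 0 \<longrightarrow> u \<bullet> (G *v u) > 0)"

lemma posdef_sym: "posdef G \<Longrightarrow> u \<bullet> (G *v v) = v \<bullet> (G *v u)"
  unfolding posdef_def by (metis dot_lmul_matrix inner_commute vector_transpose_matrix)

text \<open>Gram-Schmidt for the inner product given by \<open>G\<close>, one index at a time. Fewer
  than \<open>CARD('n)\<close> vectors cannot span, so there is always a vector left to
  orthogonalise and normalise.\<close>

lemma posdef_orthonormal_on:
  fixes G :: "real^'n^'n"
  assumes G: "posdef G" and "finite I"
  shows "\<exists>E :: 'n \<Rightarrow> real^'n. \<forall>i\<in>I. \<forall>j\<in>I. E i \<bullet> (G *v E j) = (if i = j then 1 else 0)"
  using \<open>finite I\<close>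
proof (induction I)
  case (insert a I)
  then obtain E where E: "\<And>i j. i \<in> I \<Longrightarrow> j \<in> I \<Longrightarrow> E i \<bullet> (G *v E j) = (if i = j then 1 else 0)"
    by blast
  have "dim (E ` I) \<le> card (E ` I)"
    using insert.hyps by (intro dim_le_card') simp
  also have "\<dots> \<le> card I" using insert.hyps by (intro card_image_le)
  also have "\<dots> < CARD('n)" using insert.hyps by (intro psubset_card_mono) auto
  finally have "span (E ` I) \<noteq> UNIV"
    by (metis DIM_cart DIM_real dim_UNIV dim_span less_irrefl mult.right_neutral)
  then obtain x where x: "x \<notin> span (E ` I)" by blast
  define y where "y = x - (\<Sum>i\<in>I. (E i \<bullet> (G *v x)) *\<^sub>R E i)"
  have "(\<Sum>i\<in>I. (E i \<bullet> (G *v x)) *\<^sub>R E i) \<in> span (E ` I)"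
    by (intro span_sum span_scale span_base) simp
  with x have "y \<noteq> 0" unfolding y_def by auto
  then have pos: "y \<bullet> (G *v y) > 0" using G by (simp add: posdef_def)
  have orth: "E j \<bullet> (G *v y) = 0" if "j \<in> I" for j
  proof -
    have "E j \<bullet> (G *v y) = E j \<bullet> (G *v x) - (\<Sum>i\<in>I. (E i \<bullet> (G *v x)) * (E j \<bullet> (G *v E i)))"
      by (simp add: y_def matrix_vector_mult_diff_distrib inner_diff_right
          linear_sum[OF matrix_vector_mul_linear] inner_sum_right matrix_vector_mult_scaleR)
    also have "(\<Sum>i\<in>I. (E i \<bullet> (G *v x)) * (E j \<bullet> (G *v E i)))
        = (\<Sum>i\<in>I. if i = j then E j \<bullet> (G *v x) else 0)"
      using that E by (intro sum.cong) auto
    finally show ?thesis using that insert.hyps by simp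
  qed
  define E' where "E' = E(a := (1 / sqrt (y \<bullet> (G *v y))) *\<^sub>R y)"
  have "E' i \<bullet> (G *v E' j) = (if i = j then 1 else 0)" if "i \<in> insert a I" "j \<in> insert a I" for i j
  proof -
    have "y \<bullet> (G *v E i) = 0" if "i \<in> I" for i
      using orth[OF that] posdef_sym[OF G] by metis
    then show ?thesis
      using that insert.hyps pos by (auto simp: E'_def E orth matrix_vector_mult_scaleR)
  qed
  then show ?case by blast
qed simp

lemma posdef_orthonormal:
  fixes G :: "real^'n^'n"
  assumes "posdef G"
  shows "\<exists>E :: 'n \<Rightarrow> real^'n. \<forall>i j. E i \<bullet> (G *v E j) = (if i = j then 1 else 0)"
  using posdef_orthonormal_on[OF assms, of UNIV] by simp

lemma matrix_inv_works:
  fixes A :: "real^'n^'n"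
  assumes "det A \<noteq> 0"
  shows "A ** matrix_inv A = mat 1" "matrix_inv A ** A = mat 1"
proof -
  have "\<exists>A'. A ** A' = mat 1 \<and> A' ** A = mat 1"
    using assms invertible_det_nz[of A] by (simp add: invertible_def)
  then show "A ** matrix_inv A = mat 1" "matrix_inv A ** A = mat 1"
    unfolding matrix_inv_def by (auto dest!: someI_ex)
qed

text \<open>With the frame as rows of \<open>M\<close>, orthonormality reads
  \<open>M ** (G ** transpose M) = mat 1\<close>, whence both claims. The second one makes sums over
  an orthonormal frame independent of the frame.\<close>

lemma orthonormal_matrix:
  fixes G :: "real^'n^'n" and E :: "'n \<Rightarrow> real^'n"
  assumes "\<And>i j. E i \<bullet> (G *v E j) = (if i = j then 1 else 0)"
  shows "det G > 0" "matrix_inv G $ i $ j = (\<Sum>a\<in>UNIV. E a $ i * E a $ j)"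
proof -
  define M where "M = (\<chi> a i. E a $ i)"
  have "(M ** (G ** transpose M)) $ i $ j = E i \<bullet> (G *v E j)" for i j
    unfolding inner_matrix_vector_sum
    by (simp add: M_def matrix_matrix_mult_def transpose_def sum_distrib_left mult_ac)
  then have M: "M ** (G ** transpose M) = mat 1"
    using assms by (simp add: vec_eq_iff mat_def)
  then have "det M * (det G * det M) = 1"
    by (metis det_I det_mul det_transpose)
  then have "det G * (det M)\<^sup>2 = 1" by (simp add: power2_eq_square mult_ac)
  then show "det G > 0"
    by (metis zero_less_mult_pos2 zero_less_one zero_less_power2 mult_zero_right power_zero_numeral zero_neq_one)
  have "(G ** transpose M) ** M = mat 1" using M matrix_left_right_inverse by blast
  then have "G ** (transpose M ** M) = mat 1" by (simp add: matrix_mul_assoc)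
  then have "matrix_inv G = (matrix_inv G ** G) ** (transpose M ** M)"
    by (metis matrix_mul_assoc matrix_mul_rid)
  then have "matrix_inv G = transpose M ** M"
    using matrix_inv_works(2)[of G] \<open>det G > 0\<close> by simp
  then show "matrix_inv G $ i $ j = (\<Sum>a\<in>UNIV. E a $ i * E a $ j)"
    by (simp add: M_def matrix_matrix_mult_def transpose_def)
qed

lemma posdef_det: "posdef G \<Longrightarrow> det G > 0"
  using orthonormal_matrix(1) posdef_orthonormal by blast

lemma posdef_inverse:
  assumes "posdef G"
  shows "G ** matrix_inv G = mat 1" "matrix_inv G ** G = mat 1"
  using posdef_det[OF assms] matrix_inv_works[of G] by auto

lemma continuous_on_det:
  assumes "\<And>i j. continuous_on S (\<lambda>x. A x $ i $ j :: real)"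
  shows "continuous_on S (\<lambda>x. det (A x))"
  unfolding det_def by (intro continuous_intros assms)

text \<open>Cramer's rule for the columns of the inverse. Entries of the inverse become quotients of
  determinants, which are visibly continuous.\<close>

lemma matrix_inv_component:
  fixes G :: "real^'n^'n"
  assumes "det G \<noteq> 0"
  shows "matrix_inv G $ i $ j = det (\<chi> k l. if l = i then axis j 1 $ k else G $ k $ l) / det G"
proof -
  have "G ** matrix_inv G = mat 1"
    using assms by (rule matrix_inv_works)
  then have "G *v (matrix_inv G *v axis j 1) = axis j 1"
    by (simp add: matrix_vector_mul_assoc)
  then have "matrix_inv G *v axis j 1 = (\<chi> k. det (\<chi> i l. if l = k then axis j 1 $ i else G $ i $ l) / det G)"
    using cramer[OF assms] by blast
  moreover have "(matrix_inv G *v axis j 1) $ i = matrix_inv G $ i $ j"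
    by (simp add: matrix_vector_mult_basis column_def)
  ultimately show ?thesis by simp
qed

lemma continuous_on_matrix_inv:
  fixes A :: "'x::topological_space \<Rightarrow> real^'n^'n"
  assumes "\<And>i j. continuous_on S (\<lambda>x. A x $ i $ j)" and nz: "\<And>x. x \<in> S \<Longrightarrow> det (A x) \<noteq> 0"
  shows "continuous_on S (\<lambda>x. matrix_inv (A x) $ i $ j)"
proof -
  have "continuous_on S (\<lambda>x. det (\<chi> k l. if l = i then axis j 1 $ k else A x $ k $ l) / det (A x))"
  proof (intro continuous_on_divide continuous_on_det)
    fix k l show "continuous_on S (\<lambda>x. (\<chi> k l. if l = i then axis j 1 $ k else A x $ k $ l) $ k $ l)"
      using assms(1) by (cases "l = i") auto
  qed (use assms in auto)
  then show ?thesis by (simp add: matrix_inv_component nz cong: continuous_on_cong)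
qed

section \<open>A one-variable inequality for the dilated lengths\<close>

text \<open>\<open>H'\<close> is the derivative of \<open>H r = (1 + t * (1 + 2 * r) ^ m)\<^sup>2 * r\<close>, which is half the squared
  length of the dilated section where the original one has \<open>r\<close>. The bound \<open>\<bar>p\<bar> \<le> m\<close> lets the
  growth of \<open>H'\<close> outweigh the decay of the weight \<open>(1 + 2 * H r) powr (- p)\<close>.\<close>

lemma weighted_gradient_growth:
  fixes p r C t :: real and m :: nat
  assumes "\<bar>p\<bar> \<le> m" "0 \<le> r" "(1 + 2 * r) ^ m \<le> C" "0 \<le> t" "t * C * (24 * (1 + m)\<^sup>2) \<le> 1"
  defines "f \<equiv> (1 + 2 * r) ^ m"
  defines "H' \<equiv> (1 + t * f)\<^sup>2 + 2 * (1 + t * f) * (t * (2 * m * (1 + 2 * r) ^ (m - 1))) * r"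
  shows "(1 + t) * (1 + 2 * r) powr (- p) \<le> (1 + 2 * ((1 + t * f)\<^sup>2 * r)) powr (- p) * H'\<^sup>2"
proof -
  \<comment> \<open>\<open>z\<close> is \<open>r\<close> times the logarithmic derivative of
    \<open>1 + 2 * r\<close>, so \<open>r\<close> times the derivative of \<open>f\<close> is
    \<open>m * z * f\<close>. All later estimates are in \<open>T\<close> and \<open>z\<close>
    only.\<close>
  define z where "z = 2 * r / (1 + 2 * r)"
  define T where "T = t * f"
  have u: "1 + 2 * r > 0" using \<open>0 \<le> r\<close> by simp
  have z: "0 \<le> z" "z \<le> 1" using \<open>0 \<le> r\<close> u by (auto simp: z_def field_simps)
  have f1: "1 \<le> f" using \<open>0 \<le> r\<close> by (simp add: f_def one_le_power)
  have T: "0 \<le> T" "t \<le> T" using f1 \<open>0 \<le> t\<close> mult_left_mono[OF f1, of t] by (auto simp: T_def)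
  have TC: "T * (24 * (1 + m)\<^sup>2) \<le> 1"
  proof -
    have "T \<le> t * C" unfolding T_def f_def using assms(3,4) by (rule mult_left_mono)
    then have "T * (24 * (1 + m)\<^sup>2) \<le> t * C * (24 * (1 + m)\<^sup>2)" by (intro mult_right_mono) auto
    then show ?thesis using assms(5) by linarith
  qed
  \<comment> \<open>The absolute value treats both signs of \<open>p\<close> at once: the loss
    \<open>p * ln (1 + x)\<close> never exceeds \<open>q * x\<close>.\<close>
  define q where "q = \<bar>p\<bar>"
  have q: "0 \<le> q" "q \<le> m" "p \<le> q" using assms(1) by (auto simp: q_def)
  \<comment> \<open>The case distinction is due to the truncated \<open>m - 1\<close>; for
    \<open>m = 0\<close> the coefficient makes both sides vanish.\<close>
  have fr: "real m * (1 + 2 * r) ^ (m - 1) * (2 * r) = m * z * f"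
    using u by (cases m) (auto simp: f_def z_def field_simps)
  have H': "H' = (1 + T)\<^sup>2 + 2 * (1 + T) * T * (m * z)"
  proof -
    have "H' = (1 + T)\<^sup>2 + 2 * (1 + T) * t * (real m * (1 + 2 * r) ^ (m - 1) * (2 * r))"
      by (simp add: H'_def T_def)
    then show ?thesis unfolding fr by (simp add: T_def)
  qed
  \<comment> \<open>\<open>s\<close> is the part of \<open>H'\<close> that is at most linear in
    \<open>T\<close>; the rest is nonnegative. Its square is then bounded below by
    \<open>1 + 2 * (s - 1)\<close>.\<close>
  define s where "s = 1 + 2 * T + 2 * T * (m * z)"
  have mz: "0 \<le> m * z" using z by simp
  have "s \<le> H'" unfolding H' s_def using T mz by (simp add: power2_eq_square algebra_simps)
  moreover have s1: "1 \<le> s" using T mz by (simp add: s_def)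
  ultimately have "s\<^sup>2 \<le> H'\<^sup>2" by (intro power_mono) auto
  moreover have "1 + 4 * T + 4 * T * (m * z) \<le> s\<^sup>2"
    using zero_le_square[of "s - 1"] by (simp add: s_def power2_eq_square algebra_simps)
  ultimately have H2: "1 + 4 * T + 4 * T * (m * z) \<le> H'\<^sup>2" by linarith
  \<comment> \<open>\<open>1 + x\<close> is the factor by which the dilation enlarges
    \<open>1 + 2 * r\<close>, so the weight changes by exactly
    \<open>(1 + x) powr (- p)\<close>.\<close>
  define x where "x = z * (2 * T + T\<^sup>2)"
  have x0: "0 \<le> x" using z T by (simp add: x_def)
  have "1 + 2 * ((1 + T)\<^sup>2 * r) = (1 + 2 * r) * (1 + x)"
    using u by (simp add: x_def z_def field_simps power2_eq_square)
  then have pw: "(1 + 2 * ((1 + T)\<^sup>2 * r)) powr (- p) = (1 + 2 * r) powr (- p) * (1 + x) powr (- p)"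
    using u x0 by (simp add: powr_mult)
  have "T \<le> 1"
  proof -
    have "T * 1 \<le> T * (24 * (1 + m)\<^sup>2)" using T by (intro mult_left_mono) (auto simp: power2_eq_square algebra_simps)
    then show ?thesis using TC by simp
  qed
  have "x \<le> 3 * z * T"
  proof -
    have "T\<^sup>2 \<le> T" using T \<open>T \<le> 1\<close> by (simp add: power2_eq_square mult_left_le)
    then have "z * (2 * T + T\<^sup>2) \<le> z * (3 * T)" using z by (intro mult_left_mono) auto
    then show ?thesis by (simp add: x_def)
  qed
  have "1 - 3 * q * z * T \<le> (1 + x) powr (- p)"
  proof -
    have "p * ln (1 + x) \<le> q * x"
      using q x0 ln_add_one_self_le_self[OF x0] by (intro mult_mono) auto
    also have "\<dots> \<le> q * (3 * z * T)" using q \<open>x \<le> 3 * z * T\<close> by (intro mult_left_mono)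
    finally have "1 - 3 * q * z * T \<le> 1 + (- p * ln (1 + x))" by simp
    \<comment> \<open>The exponential lies above its tangent at 0, which turns the power into a
      bound linear in \<open>T\<close>.\<close>
    also have "\<dots> \<le> exp (- p * ln (1 + x))" by (rule exp_ge_add_one_self)
    finally show ?thesis using x0 by (simp add: powr_def)
  qed
  \<comment> \<open>Origin of \<open>24 = 3 * 8\<close>: since \<open>q * z * (1 + m * z)\<close> is
    at most \<open>(1 + m)\<^sup>2\<close>, the smallness of \<open>T\<close> gives the bound
    \<open>1 / 8\<close>. The first part keeps the lower bound of the weight positive, the second
    controls the cross term of the product below.\<close>
  moreover have c: "3 * q * z * T \<le> 1 / 8" "3 * q * z * T * (1 + m * z) \<le> 1 / 8"
  proof -
    have "q * z * (1 + m * z) \<le> (1 + real m) * 1 * (1 + real m * 1)"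
      using q z mult_left_mono[of z 1 "real m"] by (intro mult_mono) auto
    then have a: "q * z * (1 + m * z) \<le> (1 + m)\<^sup>2" by (simp add: power2_eq_square algebra_simps)
    have "24 * T * (q * z * (1 + m * z)) \<le> 24 * T * (1 + m)\<^sup>2"
      using a T by (intro mult_left_mono) auto
    then show b: "3 * q * z * T * (1 + m * z) \<le> 1 / 8" using TC by (simp add: mult_ac)
    have "3 * q * z * T * 1 \<le> 3 * q * z * T * (1 + m * z)"
      using q z T mz by (intro mult_left_mono) auto
    then show "3 * q * z * T \<le> 1 / 8" using b by simp
  qed
  ultimately have "(1 - 3 * q * z * T) * (1 + 4 * T + 4 * T * (m * z)) \<le> (1 + x) powr (- p) * H'\<^sup>2"
    using H2 T mz by (intro mult_mono) auto
  \<comment> \<open>The gain \<open>4 * T * (m * z)\<close> beats the loss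
    \<open>3 * q * z * T\<close> because \<open>q \<le> m\<close>, and the cross term costs at most
    \<open>T / 2\<close>. Of the gain \<open>4 * T\<close> more than \<open>T\<close>
    remains.\<close>
  moreover have "1 + T \<le> (1 - 3 * q * z * T) * (1 + 4 * T + 4 * T * (m * z))"
  proof -
    have "3 * q * z * T \<le> 3 * (m * z) * T"
      using q z T by (intro mult_right_mono) (auto intro!: mult_right_mono)
    moreover have "4 * T * (3 * q * z * T * (1 + m * z)) \<le> 4 * T * (1 / 8)"
      using c T by (intro mult_left_mono) auto
    moreover have "(1 - 3 * q * z * T) * (1 + 4 * T + 4 * T * (m * z))
        = 1 + 4 * T + 4 * (m * z) * T - 3 * q * z * T - 4 * T * (3 * q * z * T * (1 + m * z))"
      by (simp add: algebra_simps)
    moreover have "0 \<le> m * z * T" using mz T by simp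
    ultimately show ?thesis using T by linarith
  qed
  ultimately have "1 + t \<le> (1 + x) powr (- p) * H'\<^sup>2" using T by linarith
  then have "(1 + 2 * r) powr (- p) * (1 + t) \<le> (1 + 2 * r) powr (- p) * ((1 + x) powr (- p) * H'\<^sup>2)"
    by (intro mult_left_mono) auto
  then show ?thesis using pw by (simp add: T_def mult_ac)
qed


section \<open>Coordinates on manifolds and bundles\<close>

lemma linear_axis_expansion:
  fixes f :: "real^'n \<Rightarrow> real"
  assumes "linear f"
  shows "f u = (\<Sum>i\<in>UNIV. u $ i * f (axis i 1))"
proof -
  have "f (\<Sum>i\<in>UNIV. u $ i *s axis i 1) = (\<Sum>i\<in>UNIV. u $ i * f (axis i 1))"
    by (simp add: linear_sum[OF assms] linear_scale[OF assms] scalar_mult_eq_scaleR)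
  then show ?thesis by (simp add: basis_expansion)
qed

section \<open>Smooth functions and tangent vectors in charts\<close>

context oriented_manifold
begin

lemma chart_facts:
  assumes "(U, \<phi>) \<in> atlas"
  shows "continuous_on U \<phi>" "continuous_on (\<phi> ` U) (inv_into U \<phi>)" "inj_on \<phi> U"
    "x \<in> U \<Longrightarrow> inv_into U \<phi> (\<phi> x) = x"
proof -
  note h = chart_homeomorphism[OF assms, unfolded homeomorphism_def]
  show "continuous_on U \<phi>" "continuous_on (\<phi> ` U) (inv_into U \<phi>)" "x \<in> U \<Longrightarrow> inv_into U \<phi> (\<phi> x) = x"
    using h by auto
  show "inj_on \<phi> U" using h by (metis inj_on_inverseI)
qed

lemma chart_inv_in: "y \<in> \<phi> ` W \<Longrightarrow> W \<subseteq> U \<Longrightarrow> (U, \<phi>) \<in> atlas \<Longrightarrow> inv_into U \<phi> y \<in> W"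
  using chart_facts(4) by fastforce

lemma chart_image_eq:
  assumes "(U, \<phi>) \<in> atlas"
  shows "\<phi> ` (U \<inter> W) = \<phi> ` U \<inter> inv_into U \<phi> -` W"
  using chart_facts(4)[OF assms] by (auto intro!: image_eqI)

lemma open_chart_image: "(U, \<phi>) \<in> atlas \<Longrightarrow> open W \<Longrightarrow> open (\<phi> ` (U \<inter> W))"
  unfolding chart_image_eq
  by (intro continuous_open_preimage chart_facts(2) chart_image_open)

lemma chart_at: obtains U \<phi> where "(U, \<phi>) \<in> atlas" "x \<in> U"
  using charts_cover[of x] by auto

lemma smooth_map_on_cong:
  assumes "open W" "\<And>x. x \<in> W \<Longrightarrow> f x = g x" "smooth_map_on W f"
  shows "smooth_map_on W g"
  unfolding smooth_map_on_def
proof safe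
  fix U \<phi> assume c: "(U, \<phi>) \<in> atlas"
  show "smooth_on (\<phi> ` (U \<inter> W)) (g \<circ> inv_into U \<phi>)"
  proof (rule smooth_on_cong[OF open_chart_image[OF c assms(1)]])
    show "smooth_on (\<phi> ` (U \<inter> W)) (f \<circ> inv_into U \<phi>)"
      using assms(3) c by (auto simp: smooth_map_on_def)
  qed (use assms(2) chart_facts(4)[OF c] in auto)
qed

lemma smooth_map_on_subset: "smooth_map_on W f \<Longrightarrow> W' \<subseteq> W \<Longrightarrow> smooth_map_on W' f"
  unfolding smooth_map_on_def by (fast intro: smooth_on_subset)

lemma smooth_map_on_local:
  assumes "\<And>x. x \<in> W \<Longrightarrow> \<exists>W'. open W' \<and> x \<in> W' \<and> smooth_map_on W' f"
  shows "smooth_map_on W f"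
  unfolding smooth_map_on_def
proof safe
  fix U \<phi> assume c: "(U, \<phi>) \<in> atlas"
  show "smooth_on (\<phi> ` (U \<inter> W)) (f \<circ> inv_into U \<phi>)"
  proof (rule smooth_on_local)
    fix y assume "y \<in> \<phi> ` (U \<inter> W)"
    then obtain x where x: "x \<in> U" "x \<in> W" "y = \<phi> x" by blast
    then obtain W' where "open W'" "x \<in> W'" "smooth_map_on W' f" using assms by blast
    then show "\<exists>T. open T \<and> y \<in> T \<and> smooth_on T (f \<circ> inv_into U \<phi>)"
      using open_chart_image[OF c, of W'] c x
      by (intro exI[of _ "\<phi> ` (U \<inter> W')"]) (auto simp: smooth_map_on_def)
  qed
qed

lemma smooth_map_on_const: "smooth_map_on W (\<lambda>x. c)"
  by (simp add: smooth_map_on_def smooth_on_const o_def)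

lemma smooth_map_on_add:
  "open W \<Longrightarrow> smooth_map_on W f \<Longrightarrow> smooth_map_on W g \<Longrightarrow> smooth_map_on W (\<lambda>x. f x + g x)"
  unfolding smooth_map_on_def o_def by (fast intro: smooth_on_add open_chart_image)

lemma smooth_map_on_mult:
  fixes f g :: "'a \<Rightarrow> real"
  shows "open W \<Longrightarrow> smooth_map_on W f \<Longrightarrow> smooth_map_on W g \<Longrightarrow> smooth_map_on W (\<lambda>x. f x * g x)"
  unfolding smooth_map_on_def o_def by (fast intro: smooth_on_mult open_chart_image)

lemma smooth_map_on_scaleR:
  "open W \<Longrightarrow> smooth_map_on W f \<Longrightarrow> smooth_map_on W g \<Longrightarrow> smooth_map_on W (\<lambda>x. f x *\<^sub>R g x)"
  unfolding smooth_map_on_def o_def by (fast intro: smooth_on_scaleR open_chart_image)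

lemma smooth_map_on_power:
  fixes f :: "'a \<Rightarrow> real"
  shows "open W \<Longrightarrow> smooth_map_on W f \<Longrightarrow> smooth_map_on W (\<lambda>x. f x ^ n)"
  unfolding smooth_map_on_def o_def by (fast intro: smooth_on_power open_chart_image)

lemma smooth_map_on_sum:
  assumes "open W" "\<And>i. i \<in> I \<Longrightarrow> smooth_map_on W (f i)"
  shows "smooth_map_on W (\<lambda>x. \<Sum>i\<in>I. f i x)"
  unfolding smooth_map_on_def o_def
proof safe
  fix U \<phi> assume c: "(U, \<phi>) \<in> atlas"
  have "smooth_on (\<phi> ` (U \<inter> W)) (\<lambda>x. f i (inv_into U \<phi> x))" if "i \<in> I" for i
    using assms(2)[OF that] c unfolding smooth_map_on_def o_def by fast
  then show "smooth_on (\<phi> ` (U \<inter> W)) (\<lambda>x. \<Sum>i\<in>I. f i (inv_into U \<phi> x))"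
    by (intro smooth_on_sum open_chart_image[OF c assms(1)])
qed

lemma smooth_map_on_component:
  assumes "open W" "smooth_map_on W f"
  shows "smooth_map_on W (\<lambda>x. f x $ i)"
  using assms unfolding smooth_map_on_def o_def
  by (fast intro: smooth_on_linear_comp[OF _ bounded_linear_vec_nth] open_chart_image)

lemma smooth_map_on_continuous_on:
  assumes W: "open W" and f: "smooth_map_on W f"
  shows "continuous_on W f"
proof (rule continuous_at_imp_continuous_on, rule)
  fix x assume x: "x \<in> W"
  obtain U \<phi> where c: "(U, \<phi>) \<in> atlas" "x \<in> U" by (rule chart_at)
  have "continuous_on (\<phi> ` (U \<inter> W)) (f \<circ> inv_into U \<phi>)"
    using f c(1) smooth_on_continuous_on unfolding smooth_map_on_def by fast
  moreover have "continuous_on (U \<inter> W) \<phi>"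
    by (rule continuous_on_subset[OF chart_facts(1)[OF c(1)]]) simp
  ultimately have "continuous_on (U \<inter> W) ((f \<circ> inv_into U \<phi>) \<circ> \<phi>)"
    by (intro continuous_on_compose[of "U \<inter> W" \<phi> "f \<circ> inv_into U \<phi>"])
  then have "continuous_on (U \<inter> W) f"
    by (rule continuous_on_eq) (use chart_facts(4)[OF c(1)] in auto)
  then show "isCont f x"
    using continuous_on_eq_continuous_at[of "U \<inter> W" f] chart_open[OF c(1)] W c(2) x by auto
qed

lemma smooth_imp_near: "smooth_map_on UNIV f \<Longrightarrow> smooth_near x f"
  unfolding smooth_near_def by (intro exI[of _ UNIV]) simp

lemma smooth_near_has_derivative:
  assumes c: "(U, \<phi>) \<in> atlas" "x \<in> U" and f: "smooth_near x f"
  shows "(f \<circ> inv_into U \<phi> has_derivative frechet_derivative (f \<circ> inv_into U \<phi>) (at (\<phi> x))) (at (\<phi> x))"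
proof -
  obtain W where "open W" "x \<in> W" "smooth_map_on W f"
    using f unfolding smooth_near_def by blast
  then have "smooth_on (\<phi> ` (U \<inter> W)) (f \<circ> inv_into U \<phi>)" "\<phi> x \<in> \<phi> ` (U \<inter> W)"
    using c by (auto simp: smooth_map_on_def)
  then show ?thesis by (rule smooth_on_has_derivative)
qed

lemma coord_vec_linear:
  assumes c: "(U, \<phi>) \<in> atlas" "x \<in> U"
  shows "coord_vec (U, \<phi>) x (a *\<^sub>R u + b *\<^sub>R w)
    = (\<lambda>f. a * coord_vec (U, \<phi>) x u f + b * coord_vec (U, \<phi>) x w f)"
proof
  fix f
  show "coord_vec (U, \<phi>) x (a *\<^sub>R u + b *\<^sub>R w) f = a * coord_vec (U, \<phi>) x u f + b * coord_vec (U, \<phi>) x w f"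
  proof (cases "smooth_near x f")
    case True
    then show ?thesis
      using has_derivative_linear[OF smooth_near_has_derivative[OF c True]]
      by (simp add: coord_vec_def linear_add linear_scale)
  qed (simp add: coord_vec_def)
qed

lemma linear_coord_vec_apply:
  assumes "(U, \<phi>) \<in> atlas" "x \<in> U"
  shows "linear (\<lambda>u. coord_vec (U, \<phi>) x u f)"
proof (rule linearI)
  show "coord_vec (U, \<phi>) x (u + w) f = coord_vec (U, \<phi>) x u f + coord_vec (U, \<phi>) x w f" for u w
    using coord_vec_linear[OF assms, of 1 u 1 w] by simp
  show "coord_vec (U, \<phi>) x (r *\<^sub>R u) f = r *\<^sub>R coord_vec (U, \<phi>) x u f" for r u
    using coord_vec_linear[OF assms, of r u 0 u] by simp
qed

lemma chart_change_has_derivative: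
  assumes "(U, \<phi>) \<in> atlas" "(V, \<phi>') \<in> atlas" "x \<in> U" "x \<in> V"
  shows "(\<phi>' \<circ> inv_into U \<phi> has_derivative frechet_derivative (\<phi>' \<circ> inv_into U \<phi>) (at (\<phi> x))) (at (\<phi> x))"
  using assms by (intro smooth_on_has_derivative[OF chart_change_smooth]) auto

text \<open>The chain rule through the coordinate change. Functions not smooth near \<open>x\<close>
  receive the default 0 on both sides, so the two sides agree as HOL functions.\<close>

lemma coord_vec_change:
  assumes c: "(U, \<phi>) \<in> atlas" "x \<in> U" and c': "(V, \<phi>') \<in> atlas" "x \<in> V"
  shows "coord_vec (U, \<phi>) x u
    = coord_vec (V, \<phi>') x (frechet_derivative (\<phi>' \<circ> inv_into U \<phi>) (at (\<phi> x)) u)"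
proof
  fix f
  let ?h = "\<phi>' \<circ> inv_into U \<phi>"
  show "coord_vec (U, \<phi>) x u f = coord_vec (V, \<phi>') x (frechet_derivative ?h (at (\<phi> x)) u) f"
  proof (cases "smooth_near x f")
    case True
    have hx: "?h (\<phi> x) = \<phi>' x" using chart_facts(4)[OF c(1) c(2)] by simp
    have "((f \<circ> inv_into V \<phi>') \<circ> ?h has_derivative
        frechet_derivative (f \<circ> inv_into V \<phi>') (at (\<phi>' x)) \<circ> frechet_derivative ?h (at (\<phi> x))) (at (\<phi> x))"
      using chart_change_has_derivative[OF c(1) c'(1) c(2) c'(2)] smooth_near_has_derivative[OF c' True]
      by (intro diff_chain_at) (simp_all only: hx)
    then have "(f \<circ> inv_into U \<phi> has_derivative
        frechet_derivative (f \<circ> inv_into V \<phi>') (at (\<phi>' x)) \<circ> frechet_derivative ?h (at (\<phi> x))) (at (\<phi> x))"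
    proof (rule has_derivative_transform_within_open)
      show "open (\<phi> ` (U \<inter> V))" by (intro open_chart_image c chart_open[OF c'(1)])
      show "\<phi> x \<in> \<phi> ` (U \<inter> V)" using c c' by auto
    qed (use chart_facts(4)[OF c(1)] chart_facts(4)[OF c'(1)] in auto)
    from frechet_derivative_at[OF this] show ?thesis
      using True by (simp add: coord_vec_def o_def fun_eq_iff)
  qed (simp add: coord_vec_def)
qed

text \<open>Components in any other chart are turned into components in the given one by the
  derivative of the coordinate change, so a single chart parametrises all tangent vectors.\<close>

lemma tangent_space_eq:
  assumes "(U, \<phi>) \<in> atlas" "x \<in> U"
  shows "tangent_space x = range (coord_vec (U, \<phi>) x)"
proof -
  have "coord_vec c x u \<in> range (coord_vec (U, \<phi>) x)" if "c \<in> atlas" "x \<in> fst c" for c u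
  proof -
    have "coord_vec (fst c, snd c) x u \<in> range (coord_vec (U, \<phi>) x)"
      by (subst coord_vec_change[OF _ _ assms]) (use that in simp_all)
    then show ?thesis by simp
  qed
  moreover have "coord_vec (U, \<phi>) x u \<in> tangent_space x" for u
    unfolding tangent_space_def mem_Collect_eq
    by (rule exI[of _ "(U, \<phi>)"], rule exI[of _ u]) (simp add: assms)
  ultimately show ?thesis unfolding tangent_space_def by blast
qed

text \<open>Coordinate functions serve as test functions from which the components of a tangent
  vector are read off. They are smooth on \<open>U\<close> only, which suffices because tangent
  vectors act on functions smooth near \<open>x\<close>.\<close>

lemma coord_vec_component:
  assumes c: "(U, \<phi>) \<in> atlas" "x \<in> U"
  shows "coord_vec (U, \<phi>) x u (\<lambda>x. \<phi> x $ i) = u $ i"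
proof -
  have "smooth_map_on U \<phi>"
    using chart_change_smooth[OF _ c(1)] by (auto simp: smooth_map_on_def)
  then have "smooth_map_on U (\<lambda>x. \<phi> x $ i)"
    by (intro smooth_map_on_component chart_open[OF c(1)])
  then have near: "smooth_near x (\<lambda>x. \<phi> x $ i)"
    unfolding smooth_near_def using chart_open[OF c(1)] c(2) by (intro exI[of _ U]) simp
  have "((\<lambda>y. y $ i) has_derivative (\<lambda>u. u $ i)) (at (\<phi> x))"
    by (rule bounded_linear_imp_has_derivative[OF bounded_linear_vec_nth])
  then have "((\<lambda>x. \<phi> x $ i) \<circ> inv_into U \<phi> has_derivative (\<lambda>u. u $ i)) (at (\<phi> x))"
    by (rule has_derivative_transform_within_open[OF _ chart_image_open[OF c(1)]])
      (use c chart_facts(4)[OF c(1)] in auto)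
  then have "frechet_derivative ((\<lambda>x. \<phi> x $ i) \<circ> inv_into U \<phi>) (at (\<phi> x)) = (\<lambda>u. u $ i)"
    by (rule frechet_derivative_at[symmetric])
  with near show ?thesis
    by (simp add: coord_vec_def)
qed

lemma coord_vec_inj:
  assumes c: "(U, \<phi>) \<in> atlas" "x \<in> U" and "coord_vec (U, \<phi>) x u = coord_vec (U, \<phi>) x w"
  shows "u = w"
  using coord_vec_component[OF c, of u] coord_vec_component[OF c, of w] assms(3)
  by (simp add: vec_eq_iff)

text \<open>The vector of partial derivatives, that is, the components of the covector
  \<open>df\<close>. The metric gradient arises from it by the inverse Gram matrix.\<close>

definition chart_gradient :: "('a, 'n) chart \<Rightarrow> ('a \<Rightarrow> real) \<Rightarrow> 'a \<Rightarrow> real^'n" where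
  "chart_gradient c f x = (\<chi> i. coord_vec c x (axis i 1) f)"

lemma coord_vec_eq_inner:
  assumes "(U, \<phi>) \<in> atlas" "x \<in> U"
  shows "coord_vec (U, \<phi>) x u f = u \<bullet> chart_gradient (U, \<phi>) f x"
  using linear_axis_expansion[OF linear_coord_vec_apply[OF assms], of u f]
  by (simp add: chart_gradient_def inner_vec_def)

lemma chart_gradient_continuous:
  assumes c: "(U, \<phi>) \<in> atlas" and f: "smooth_map_on UNIV f"
  shows "continuous_on U (\<lambda>x. chart_gradient (U, \<phi>) f x $ i)"
proof -
  have s: "smooth_on (\<phi> ` U) (f \<circ> inv_into U \<phi>)"
    using f c unfolding smooth_map_on_def by fastforce
  have "continuous_on (\<phi> ` U) (\<lambda>y. frechet_derivative (f \<circ> inv_into U \<phi>) (at y) (axis i 1))"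
    by (intro smooth_on_continuous_on smooth_on_frechet_derivative s)
  then have "continuous_on U (\<lambda>x. frechet_derivative (f \<circ> inv_into U \<phi>) (at (\<phi> x)) (axis i 1))"
    by (rule continuous_on_compose2[OF _ chart_facts(1)[OF c]]) simp
  then show ?thesis by (simp add: chart_gradient_def coord_vec_def smooth_imp_near[OF f])
qed

end

section \<open>Metric, orthonormal frames and gradients in charts\<close>

context oriented_riemannian_manifold
begin

lemma coord_vec_tangent: "(U, \<phi>) \<in> atlas \<Longrightarrow> x \<in> U \<Longrightarrow> coord_vec (U, \<phi>) x u \<in> tangent_space x"
  by (simp add: tangent_space_eq)

lemma g_coord_linear:
  assumes c: "(U, \<phi>) \<in> atlas" "x \<in> U" and z: "z \<in> tangent_space x"
  shows "linear (\<lambda>u. g x (coord_vec (U, \<phi>) x u) z)"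
proof (rule linearI)
  note v = coord_vec_tangent[OF c]
  show "g x (coord_vec (U, \<phi>) x (u + w)) z = g x (coord_vec (U, \<phi>) x u) z + g x (coord_vec (U, \<phi>) x w) z" for u w
    using g_linear[OF v v z, of 1 u 1 w] coord_vec_linear[OF c, of 1 u 1 w] by simp
  show "g x (coord_vec (U, \<phi>) x (r *\<^sub>R u)) z = r *\<^sub>R g x (coord_vec (U, \<phi>) x u) z" for r u
    using g_linear[OF v v z, of r u 0 u] coord_vec_linear[OF c, of r u 0 u] by simp
qed

lemma g_coord_vec:
  assumes c: "(U, \<phi>) \<in> atlas" "x \<in> U"
  shows "g x (coord_vec (U, \<phi>) x u) (coord_vec (U, \<phi>) x w) = u \<bullet> (gram (U, \<phi>) x *v w)"
proof -
  note v = coord_vec_tangent[OF c]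
  have "g x (coord_vec (U, \<phi>) x u) (coord_vec (U, \<phi>) x w)
      = (\<Sum>i\<in>UNIV. u $ i * g x (coord_vec (U, \<phi>) x (axis i 1)) (coord_vec (U, \<phi>) x w))"
    by (rule linear_axis_expansion[OF g_coord_linear[OF c v]])
  also have "\<dots> = (\<Sum>i\<in>UNIV. u $ i * (\<Sum>j\<in>UNIV. w $ j * gram (U, \<phi>) x $ i $ j))"
  proof (intro sum.cong refl arg_cong2[where f = "(*)"])
    fix i
    have "g x (coord_vec (U, \<phi>) x w) (coord_vec (U, \<phi>) x (axis i 1))
        = (\<Sum>j\<in>UNIV. w $ j * g x (coord_vec (U, \<phi>) x (axis j 1)) (coord_vec (U, \<phi>) x (axis i 1)))"
      by (rule linear_axis_expansion[OF g_coord_linear[OF c v]])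
    then show "g x (coord_vec (U, \<phi>) x (axis i 1)) (coord_vec (U, \<phi>) x w)
        = (\<Sum>j\<in>UNIV. w $ j * gram (U, \<phi>) x $ i $ j)"
      using g_sym[OF v v] by (simp add: gram_def)
  qed
  finally show ?thesis by (simp add: inner_matrix_vector_sum sum_distrib_left mult_ac)
qed

lemma posdef_gram:
  assumes c: "(U, \<phi>) \<in> atlas" "x \<in> U"
  shows "posdef (gram (U, \<phi>) x)"
  unfolding posdef_def
proof safe
  show "transpose (gram (U, \<phi>) x) = gram (U, \<phi>) x"
    using g_sym[OF coord_vec_tangent[OF c] coord_vec_tangent[OF c]]
    by (simp add: gram_def transpose_def vec_eq_iff)
  fix u :: "real^'n" assume "u \<noteq> 0"
  have "coord_vec (U, \<phi>) x 0 = (\<lambda>f. 0)" using coord_vec_linear[OF c, of 0 0 0 0] by simp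
  then have "coord_vec (U, \<phi>) x u \<noteq> (\<lambda>f. 0)" using coord_vec_inj[OF c, of u 0] \<open>u \<noteq> 0\<close> by auto
  then show "0 < u \<bullet> (gram (U, \<phi>) x *v u)"
    using g_pos[OF coord_vec_tangent[OF c], of u] g_coord_vec[OF c, of u u] by simp
qed

lemma gram_continuous:
  assumes "(U, \<phi>) \<in> atlas"
  shows "continuous_on U (\<lambda>x. gram (U, \<phi>) x $ i $ j)"
  using smooth_map_on_continuous_on[OF chart_open[OF assms] g_smooth[OF assms, unfolded fst_conv]]
  by (simp add: gram_def)

lemma gram_inv_continuous:
  assumes "(U, \<phi>) \<in> atlas"
  shows "continuous_on U (\<lambda>x. matrix_inv (gram (U, \<phi>) x) $ i $ j)"
  by (intro continuous_on_matrix_inv gram_continuous assms)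
    (use posdef_det[OF posdef_gram[OF assms]] in fastforce)

text \<open>Gram-Schmidt shows that the choice operator does pick an orthonormal frame. Whichever it
  picks, the second property ties it to the inverse Gram matrix, and nothing more about the frame is
  needed.\<close>

lemma some_orthonormal_frame:
  assumes c: "(U, \<phi>) \<in> atlas" "x \<in> U"
  obtains e where "(SOME E. orthonormal_frame_at x E) = (\<lambda>a. coord_vec (U, \<phi>) x (e a))"
    "\<And>i j. matrix_inv (gram (U, \<phi>) x) $ i $ j = (\<Sum>a\<in>UNIV. e a $ i * e a $ j)"
proof -
  obtain e :: "'n \<Rightarrow> real^'n" where e: "\<And>i j. e i \<bullet> (gram (U, \<phi>) x *v e j) = (if i = j then 1 else 0)"
    using posdef_orthonormal[OF posdef_gram[OF c]] by auto
  have "orthonormal_frame_at x (\<lambda>a. coord_vec (U, \<phi>) x (e a))"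
    unfolding orthonormal_frame_at_def using e by (simp add: g_coord_vec[OF c] coord_vec_tangent[OF c])
  then have E: "orthonormal_frame_at x (SOME E. orthonormal_frame_at x E)"
    by (rule someI[of "orthonormal_frame_at x"])
  have "\<exists>e'. \<forall>a. (SOME E. orthonormal_frame_at x E) a = coord_vec (U, \<phi>) x (e' a)"
    using E unfolding orthonormal_frame_at_def tangent_space_eq[OF c] by (intro choice) blast
  then obtain e' where e': "(SOME E. orthonormal_frame_at x E) = (\<lambda>a. coord_vec (U, \<phi>) x (e' a))"
    by auto
  have "e' i \<bullet> (gram (U, \<phi>) x *v e' j) = (if i = j then 1 else 0)" for i j
    using E[unfolded e'] unfolding orthonormal_frame_at_def g_coord_vec[OF c] by blast
  then show ?thesis by (intro that[OF e'] orthonormal_matrix(2))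
qed

text \<open>Resolves the definite description: pairing with all tangent vectors amounts to the
  linear system with the Gram matrix and right-hand side \<open>df\<close>, whose solution exists
  and is unique by invertibility.\<close>

lemma gradient_coord:
  assumes c: "(U, \<phi>) \<in> atlas" "x \<in> U"
  shows "gradient f x = coord_vec (U, \<phi>) x (matrix_inv (gram (U, \<phi>) x) *v chart_gradient (U, \<phi>) f x)"
  unfolding gradient_def
proof (rule the_equality)
  let ?G = "gram (U, \<phi>) x" and ?d = "chart_gradient (U, \<phi>) f x"
  have inv: "?G *v (matrix_inv ?G *v ?d) = ?d"
    by (simp add: matrix_vector_mul_assoc posdef_inverse(1)[OF posdef_gram[OF c]])
  show "coord_vec (U, \<phi>) x (matrix_inv ?G *v ?d) \<in> tangent_space x \<and>
    (\<forall>w\<in>tangent_space x. g x (coord_vec (U, \<phi>) x (matrix_inv ?G *v ?d)) w = w f)"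
  proof safe
    fix w assume "w \<in> tangent_space x"
    then obtain u where u: "w = coord_vec (U, \<phi>) x u" by (auto simp: tangent_space_eq[OF c])
    have "g x (coord_vec (U, \<phi>) x (matrix_inv ?G *v ?d)) w = u \<bullet> (?G *v (matrix_inv ?G *v ?d))"
      unfolding u g_coord_vec[OF c] by (rule posdef_sym[OF posdef_gram[OF c]])
    then show "g x (coord_vec (U, \<phi>) x (matrix_inv ?G *v ?d)) w = w f"
      by (simp add: inv u coord_vec_eq_inner[OF c])
  qed (rule coord_vec_tangent[OF c])
  fix v assume v: "v \<in> tangent_space x \<and> (\<forall>w\<in>tangent_space x. g x v w = w f)"
  then obtain u where u: "v = coord_vec (U, \<phi>) x u" by (auto simp: tangent_space_eq[OF c])
  have "w \<bullet> (?G *v u) = w \<bullet> ?d" for w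
  proof -
    have "g x v (coord_vec (U, \<phi>) x w) = coord_vec (U, \<phi>) x w f" using v coord_vec_tangent[OF c] by blast
    then show ?thesis
      using posdef_sym[OF posdef_gram[OF c], of w u] by (simp add: u g_coord_vec[OF c] coord_vec_eq_inner[OF c])
  qed
  then have "?G *v u = ?d" using vector_eq_ldot by blast
  then have "matrix_inv ?G *v (?G *v u) = matrix_inv ?G *v ?d" by simp
  then show "v = coord_vec (U, \<phi>) x (matrix_inv ?G *v ?d)"
    by (simp add: u matrix_vector_mul_assoc posdef_inverse(2)[OF posdef_gram[OF c]])
qed

lemma grad_inner_coord:
  assumes c: "(U, \<phi>) \<in> atlas" "x \<in> U"
  shows "g x (gradient f x) (gradient f x)
    = chart_gradient (U, \<phi>) f x \<bullet> (matrix_inv (gram (U, \<phi>) x) *v chart_gradient (U, \<phi>) f x)"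
  by (simp add: gradient_coord[OF c] g_coord_vec[OF c] matrix_vector_mul_assoc
      posdef_inverse(1)[OF posdef_gram[OF c]] inner_commute)

text \<open>With \<open>?u\<close> the components of the gradient, the squared norm is the positive
  definite form at \<open>?u\<close>. If it vanishes, then so does \<open>?u\<close>, and with it
  \<open>df\<close>, the image of \<open>?u\<close> under the Gram matrix.\<close>

lemma grad_inner_nonneg: "0 \<le> g x (gradient f x) (gradient f x)"
  and grad_inner_eq_0: "(U, \<phi>) \<in> atlas \<Longrightarrow> x \<in> U \<Longrightarrow>
    g x (gradient f x) (gradient f x) = 0 \<Longrightarrow> chart_gradient (U, \<phi>) f x = 0"
proof -
  have *: "0 \<le> g x (gradient f x) (gradient f x) \<and>
      (g x (gradient f x) (gradient f x) = 0 \<longrightarrow> chart_gradient (U, \<phi>) f x = 0)"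
    if c: "(U, \<phi>) \<in> atlas" "x \<in> U" for U \<phi>
  proof -
    let ?u = "matrix_inv (gram (U, \<phi>) x) *v chart_gradient (U, \<phi>) f x"
    have d: "gram (U, \<phi>) x *v ?u = chart_gradient (U, \<phi>) f x"
      by (simp add: matrix_vector_mul_assoc posdef_inverse(1)[OF posdef_gram[OF c]])
    show ?thesis
    proof (cases "?u = 0")
      case True
      then show ?thesis using d by (simp add: gradient_coord[OF c] g_coord_vec[OF c])
    next
      case False
      then have "0 < ?u \<bullet> (gram (U, \<phi>) x *v ?u)"
        using posdef_gram[OF c] unfolding posdef_def by blast
      then show ?thesis by (simp add: gradient_coord[OF c] g_coord_vec[OF c])
    qed
  qed
  show "0 \<le> g x (gradient f x) (gradient f x)" using * chart_at[of x] by blast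
  show "(U, \<phi>) \<in> atlas \<Longrightarrow> x \<in> U \<Longrightarrow>
    g x (gradient f x) (gradient f x) = 0 \<Longrightarrow> chart_gradient (U, \<phi>) f x = 0" using * by blast
qed

lemma grad_inner_continuous:
  assumes "smooth_map_on UNIV f"
  shows "continuous_on UNIV (\<lambda>x. g x (gradient f x) (gradient f x))"
proof (rule continuous_at_imp_continuous_on, rule)
  fix x :: 'a
  obtain U \<phi> where c: "(U, \<phi>) \<in> atlas" "x \<in> U" by (rule chart_at)
  have "continuous_on U (\<lambda>x. \<Sum>i\<in>UNIV. \<Sum>j\<in>UNIV. chart_gradient (U, \<phi>) f x $ i
      * chart_gradient (U, \<phi>) f x $ j * matrix_inv (gram (U, \<phi>) x) $ i $ j)"
    by (intro continuous_intros chart_gradient_continuous gram_inv_continuous c assms)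
  then have "continuous_on U (\<lambda>x. g x (gradient f x) (gradient f x))"
    by (rule continuous_on_eq) (simp add: grad_inner_coord[OF c(1)] inner_matrix_vector_sum)
  then show "isCont (\<lambda>x. g x (gradient f x) (gradient f x)) x"
    using continuous_on_eq_continuous_at chart_open[OF c(1)] c(2) by blast
qed

end

section \<open>Fibrewise algebra and radial variations of sections\<close>

context oriented_vector_bundle
begin

lemma proj_fibre_inv: "(V, \<psi>) \<in> triv \<Longrightarrow> x \<in> V \<Longrightarrow> proj (fibre_inv proj \<psi> x y) = x"
  using triv_bij[of V \<psi> x] inv_into_into[of y \<psi> "proj -` {x}"]
  by (auto simp: fibre_inv_def bij_betw_def)

lemma triv_fibre_inv: "(V, \<psi>) \<in> triv \<Longrightarrow> x \<in> V \<Longrightarrow> \<psi> (fibre_inv proj \<psi> x y) = y"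
  using triv_bij[of V \<psi> x] by (auto simp: fibre_inv_def bij_betw_def f_inv_into_f)

lemma triv_inj:
  assumes "(V, \<psi>) \<in> triv" "proj e \<in> V" "proj e' = proj e" "\<psi> e = \<psi> e'"
  shows "e = e'"
  using triv_bij[OF assms(1,2)] assms(3,4) by (auto simp: bij_betw_def inj_on_def)

lemma triv_at: obtains V \<psi> where "(V, \<psi>) \<in> triv" "x \<in> V"
  using triv_cover[of x] by auto

text \<open>Vector space laws on the fibres are not axioms; they are checked after applying a
  trivialisation and pulled back by its injectivity.\<close>

lemma scale_one: "scale 1 e = e"
proof -
  obtain V \<psi> where V: "(V, \<psi>) \<in> triv" "proj e \<in> V" by (rule triv_at)
  show ?thesis using V by (intro triv_inj[OF V(1)]) (simp_all add: proj_scale triv_scale)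
qed

lemma fibre_inv_linear:
  assumes V: "(V, \<psi>) \<in> triv" "x \<in> V"
  shows "fibre_inv proj \<psi> x (a *\<^sub>R y + b *\<^sub>R z)
    = add (scale a (fibre_inv proj \<psi> x y)) (scale b (fibre_inv proj \<psi> x z))"
  by (rule triv_inj[OF V(1)])
    (simp_all add: V proj_add proj_scale proj_fibre_inv[OF V] triv_fibre_inv[OF V] triv_add[OF V(1)] triv_scale[OF V(1)])

lemma smooth_section_scale:
  assumes f: "smooth_map_on UNIV f" and s: "smooth_section \<sigma>"
  shows "smooth_section (\<lambda>x. scale (f x) (\<sigma> x))"
  unfolding smooth_section_def
proof safe
  show "proj (scale (f x) (\<sigma> x)) = x" for x
    using s by (simp add: proj_scale smooth_section_def)
  fix V \<psi> assume V: "(V, \<psi>) \<in> triv"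
  have o: "open V" by (rule triv_open[OF V])
  have "smooth_map_on V (\<lambda>x. f x *\<^sub>R \<psi> (\<sigma> x))"
    using s V by (intro smooth_map_on_scaleR o smooth_map_on_subset[OF f]) (auto simp: smooth_section_def)
  then show "smooth_map_on V (\<lambda>x. \<psi> (scale (f x) (\<sigma> x)))"
    by (rule smooth_map_on_cong[OF o, rotated]) (use s V in \<open>simp add: triv_scale smooth_section_def\<close>)
qed

text \<open>In coordinates the variation is \<open>1 + t * f\<close> times the section, a product
  built from the time projection and from functions of the point alone. It makes sense for all
  times; the bound 1 is merely a choice.\<close>

lemma smooth_variation_scale:
  assumes f: "smooth_map_on UNIV f" and s: "smooth_section \<sigma>"
  shows "smooth_variation \<sigma> 1 (\<lambda>t x. scale (1 + t * f x) (\<sigma> x))"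
  unfolding smooth_variation_def
proof safe
  show "(\<lambda>x. scale (1 + 0 * f x) (\<sigma> x)) = \<sigma>" by (simp add: scale_one)
  show "proj (scale (1 + t * f x) (\<sigma> x)) = x" for t x
    using s by (simp add: proj_scale smooth_section_def)
  fix U \<phi> V \<psi> assume c: "(U, \<phi>) \<in> atlas" and V: "(V, \<psi>) \<in> triv"
  let ?W = "\<phi> ` (U \<inter> V)" and ?i = "inv_into U \<phi>"
  let ?S = "{-1<..<1::real} \<times> ?W"
  have oW: "open ?W" by (intro open_chart_image c triv_open[OF V])
  then have o: "open ?S" by (intro open_Times) auto
  have snd: "smooth_on ?S (\<lambda>z. u (snd z))" if "smooth_on ?W u" for u :: "real^'n \<Rightarrow> 'w::real_normed_vector"
    by (rule smooth_on_comp_linear[OF o bounded_linear_snd _ that]) auto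
  have "smooth_on ?W (f \<circ> ?i)"
    using smooth_map_on_subset[OF f, of V] c by (auto simp: smooth_map_on_def)
  then have F: "smooth_on ?S (\<lambda>z. f (?i (snd z)))" using snd by (simp add: o_def)
  have "smooth_on ?W ((\<lambda>x. \<psi> (\<sigma> x)) \<circ> ?i)"
    using s V c by (auto simp: smooth_section_def smooth_map_on_def)
  then have P: "smooth_on ?S (\<lambda>z. \<psi> (\<sigma> (?i (snd z))))" using snd by (simp add: o_def)
  have "smooth_on ?S (\<lambda>z. (1 + fst z * f (?i (snd z))) *\<^sub>R \<psi> (\<sigma> (?i (snd z))))"
    by (intro smooth_on_scaleR smooth_on_add smooth_on_mult smooth_on_const
        smooth_on_bounded_linear[OF bounded_linear_fst] o F P)
  then show "smooth_on ({-1<..<1} \<times> \<phi> ` (U \<inter> V)) (\<lambda>(t, y). \<psi> (scale (1 + t * f (?i y)) (\<sigma> (?i y))))"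
  proof (rule smooth_on_cong[OF o, rotated])
    fix z assume "z \<in> ?S"
    then have "?i (snd z) \<in> V" using chart_inv_in[of "snd z" \<phi> "U \<inter> V" U] c by auto
    then show "(1 + fst z * f (?i (snd z))) *\<^sub>R \<psi> (\<sigma> (?i (snd z)))
        = (case z of (t, y) \<Rightarrow> \<psi> (scale (1 + t * f (?i y)) (\<sigma> (?i y))))"
      using s V by (simp add: case_prod_beta triv_scale smooth_section_def)
  qed
qed simp

end

section \<open>Fibre metric and covariant derivative in coordinates\<close>

context riemannian_vector_bundle_with_connection
begin

text \<open>Linearity is available in the first argument, and symmetry carries it to the second.
  Each fibre vector is recovered from its trivialised components by
  \<open>fibre_inv\<close>.\<close>

lemma fm_coord:
  assumes V: "(V, \<psi>) \<in> triv" "x \<in> V" and e: "proj e = x" "proj e' = x"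
  shows "fm e e' = (\<Sum>k\<in>UNIV. \<Sum>l\<in>UNIV. \<psi> e $ k * \<psi> e' $ l *
    fm (fibre_inv proj \<psi> x (axis k 1)) (fibre_inv proj \<psi> x (axis l 1)))"
proof -
  let ?i = "fibre_inv proj \<psi> x"
  have i: "?i (\<psi> d) = d" if "proj d = x" for d
    using that V by (intro triv_inj[OF V(1)]) (simp_all add: proj_fibre_inv triv_fibre_inv)
  have lin: "linear (\<lambda>y. fm (?i y) d)" if "proj d = x" for d
  proof (rule linearI)
    show "fm (?i (y + z)) d = fm (?i y) d + fm (?i z) d" for y z
      using fibre_inv_linear[OF V, of 1 y 1 z] fm_linear[of "?i y" d "?i z" 1 1] that
      by (simp add: proj_fibre_inv[OF V])
    show "fm (?i (r *\<^sub>R y)) d = r *\<^sub>R fm (?i y) d" for r y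
      using fibre_inv_linear[OF V, of r y 0 y] fm_linear[of "?i y" d "?i y" r 0] that
      by (simp add: proj_fibre_inv[OF V])
  qed
  have "fm (?i (\<psi> e)) (?i (\<psi> e')) = (\<Sum>k\<in>UNIV. \<psi> e $ k * fm (?i (axis k 1)) (?i (\<psi> e')))"
    by (rule linear_axis_expansion[OF lin]) (simp add: proj_fibre_inv[OF V])
  also have "\<dots> = (\<Sum>k\<in>UNIV. \<psi> e $ k * (\<Sum>l\<in>UNIV. \<psi> e' $ l * fm (?i (axis k 1)) (?i (axis l 1))))"
  proof (intro sum.cong refl arg_cong2[where f = "(*)"])
    fix k
    have "fm (?i (\<psi> e')) (?i (axis k 1)) = (\<Sum>l\<in>UNIV. \<psi> e' $ l * fm (?i (axis l 1)) (?i (axis k 1)))"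
      by (rule linear_axis_expansion[OF lin]) (simp add: proj_fibre_inv[OF V])
    then show "fm (?i (axis k 1)) (?i (\<psi> e')) = (\<Sum>l\<in>UNIV. \<psi> e' $ l * fm (?i (axis k 1)) (?i (axis l 1)))"
      by (simp add: fm_sym[of "?i (axis k 1)"] proj_fibre_inv[OF V])
  qed
  finally show ?thesis by (simp add: i e sum_distrib_left mult_ac)
qed

lemma fm_scale: "proj e = proj e' \<Longrightarrow> fm (scale a e) (scale b e') = a * b * fm e e'"
proof -
  assume e: "proj e = proj e'"
  obtain V \<psi> where V: "(V, \<psi>) \<in> triv" "proj e' \<in> V" by (rule triv_at)
  show ?thesis
    using V(1) e V(2) by (simp add: fm_coord[OF V] proj_scale triv_scale sum_distrib_left mult_ac)
qed

lemma fm_nonneg: "0 \<le> fm e e"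
proof (cases "e = scale 0 e")
  case True
  then have "fm e e = 0" using fm_scale[of e e 0 0] by simp
  then show ?thesis by simp
qed (use fm_pos in fastforce)

lemma fibre_norm_sq: "(fibre_norm e)\<^sup>2 = fm e e"
  by (simp add: fibre_norm_def fm_nonneg)

lemma fm_continuous:
  assumes V: "(V, \<psi>) \<in> triv" and "W \<subseteq> V"
    and s: "\<And>x. x \<in> W \<Longrightarrow> proj (s x) = x" "continuous_on W (\<lambda>x. \<psi> (s x))"
    and t: "\<And>x. x \<in> W \<Longrightarrow> proj (t x) = x" "continuous_on W (\<lambda>x. \<psi> (t x))"
  shows "continuous_on W (\<lambda>x. fm (s x) (t x))"
proof -
  have "continuous_on W (\<lambda>x. fm (fibre_inv proj \<psi> x y) (fibre_inv proj \<psi> x z))" for y z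
    using smooth_map_on_continuous_on[OF triv_open[OF V] fm_smooth[OF V]] \<open>W \<subseteq> V\<close>
    by (rule continuous_on_subset)
  then have "continuous_on W (\<lambda>x. \<Sum>k\<in>UNIV. \<Sum>l\<in>UNIV. \<psi> (s x) $ k * \<psi> (t x) $ l *
    fm (fibre_inv proj \<psi> x (axis k 1)) (fibre_inv proj \<psi> x (axis l 1)))"
    by (intro continuous_intros s t)
  then show ?thesis
    by (rule continuous_on_eq) (use fm_coord[OF V] s(1) t(1) \<open>W \<subseteq> V\<close> in \<open>auto simp: subset_iff\<close>)
qed

lemma smooth_half_square_length:
  assumes s: "smooth_section \<sigma>"
  shows "smooth_map_on UNIV (half_square_length \<sigma>)"
proof (rule smooth_map_on_local)
  fix x :: 'a
  obtain V \<psi> where V: "(V, \<psi>) \<in> triv" "x \<in> V" by (rule triv_at)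
  have o: "open V" by (rule triv_open[OF V(1)])
  have P: "smooth_map_on V (\<lambda>x. \<psi> (\<sigma> x))" using s V by (auto simp: smooth_section_def)
  have "smooth_map_on V (\<lambda>x. 1 / 2 * (\<Sum>k\<in>UNIV. \<Sum>l\<in>UNIV. \<psi> (\<sigma> x) $ k * \<psi> (\<sigma> x) $ l *
    fm (fibre_inv proj \<psi> x (axis k 1)) (fibre_inv proj \<psi> x (axis l 1))))"
    by (intro smooth_map_on_mult smooth_map_on_const smooth_map_on_sum smooth_map_on_component
        fm_smooth[OF V(1)] o P)
  then have "smooth_map_on V (half_square_length \<sigma>)"
    by (rule smooth_map_on_cong[OF o, rotated])
      (use s in \<open>simp add: half_square_length_def fibre_norm_sq fm_coord[OF V(1)] smooth_section_def\<close>)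
  then show "\<exists>W'. open W' \<and> x \<in> W' \<and> smooth_map_on W' (half_square_length \<sigma>)"
    using o V(2) by blast
qed

text \<open>The trace of the bilinear form \<open>\<langle>D u, D w\<rangle>\<close> with respect to
  the inverse Gram matrix. This removes the chosen frame, which need not depend continuously on the
  point.\<close>

lemma deriv_norm_sq_coord:
  assumes c: "(U, \<phi>) \<in> atlas" "x \<in> U" and s: "smooth_section \<sigma>"
  shows "deriv_norm_sq \<sigma> x = (\<Sum>i\<in>UNIV. \<Sum>j\<in>UNIV. matrix_inv (gram (U, \<phi>) x) $ i $ j *
    fm (D x (coord_vec (U, \<phi>) x (axis i 1)) \<sigma>) (D x (coord_vec (U, \<phi>) x (axis j 1)) \<sigma>))"
proof -
  let ?D = "\<lambda>u. D x (coord_vec (U, \<phi>) x u) \<sigma>"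
  note v = coord_vec_tangent[OF c]
  have p: "proj (?D u) = x" for u by (rule connection_fibre[OF s v])
  have D: "?D (a *\<^sub>R u + b *\<^sub>R w) = add (scale a (?D u)) (scale b (?D w))" for a b u w
    unfolding coord_vec_linear[OF c] by (rule connection_linear[OF s v v])
  have lin: "linear (\<lambda>u. fm (?D u) (?D w))" for w
  proof (rule linearI)
    show "fm (?D (y + z)) (?D w) = fm (?D y) (?D w) + fm (?D z) (?D w)" for y z
      using D[of 1 y 1 z] fm_linear[of "?D y" "?D w" "?D z" 1 1] by (simp add: p)
    show "fm (?D (r *\<^sub>R y)) (?D w) = r *\<^sub>R fm (?D y) (?D w)" for r y
      using D[of r y 0 y] fm_linear[of "?D y" "?D w" "?D y" r 0] by (simp add: p)
  qed
  have bil: "fm (?D u) (?D u) = (\<Sum>i\<in>UNIV. \<Sum>j\<in>UNIV. u $ i * u $ j * fm (?D (axis i 1)) (?D (axis j 1)))" for u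
  proof -
    have "fm (?D u) (?D u) = (\<Sum>i\<in>UNIV. u $ i * fm (?D (axis i 1)) (?D u))"
      by (rule linear_axis_expansion[OF lin])
    also have "\<dots> = (\<Sum>i\<in>UNIV. u $ i * (\<Sum>j\<in>UNIV. u $ j * fm (?D (axis i 1)) (?D (axis j 1))))"
    proof (intro sum.cong refl arg_cong2[where f = "(*)"])
      fix i
      have "fm (?D u) (?D (axis i 1)) = (\<Sum>j\<in>UNIV. u $ j * fm (?D (axis j 1)) (?D (axis i 1)))"
        by (rule linear_axis_expansion[OF lin])
      then show "fm (?D (axis i 1)) (?D u) = (\<Sum>j\<in>UNIV. u $ j * fm (?D (axis i 1)) (?D (axis j 1)))"
        by (simp add: fm_sym[of "?D (axis i 1)"] p)
    qed
    finally show ?thesis by (simp add: sum_distrib_left mult_ac)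
  qed
  obtain e where e: "(SOME E. orthonormal_frame_at x E) = (\<lambda>a. coord_vec (U, \<phi>) x (e a))"
    "\<And>i j. matrix_inv (gram (U, \<phi>) x) $ i $ j = (\<Sum>a\<in>UNIV. e a $ i * e a $ j)"
    by (rule some_orthonormal_frame[OF c]) blast
  have "deriv_norm_sq \<sigma> x = (\<Sum>a\<in>UNIV. fm (?D (e a)) (?D (e a)))"
    by (simp add: deriv_norm_sq_def e(1) fibre_norm_sq)
  also have "\<dots> = (\<Sum>i\<in>UNIV. \<Sum>a\<in>UNIV. \<Sum>j\<in>UNIV. e a $ i * e a $ j * fm (?D (axis i 1)) (?D (axis j 1)))"
    unfolding bil by (rule sum.swap)
  also have "\<dots> = (\<Sum>i\<in>UNIV. \<Sum>j\<in>UNIV. \<Sum>a\<in>UNIV. e a $ i * e a $ j * fm (?D (axis i 1)) (?D (axis j 1)))"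
    by (intro sum.cong refl sum.swap)
  finally show ?thesis by (simp add: e(2) sum_distrib_right)
qed

text \<open>The derivative term cancels in the difference of two energies only after the energy
  integrals have been split, which requires this term to be integrable; continuity on a compact
  manifold ensures that.\<close>

lemma deriv_norm_sq_continuous:
  assumes s: "smooth_section \<sigma>"
  shows "continuous_on UNIV (deriv_norm_sq \<sigma>)"
proof (rule continuous_at_imp_continuous_on, rule)
  fix x :: 'a
  obtain U \<phi> where c: "(U, \<phi>) \<in> atlas" "x \<in> U" by (rule chart_at)
  obtain V \<psi> where V: "(V, \<psi>) \<in> triv" "x \<in> V" by (rule triv_at)
  have o: "open (U \<inter> V)" by (intro open_Int chart_open[OF c(1)] triv_open[OF V(1)])
  have "continuous_on (U \<inter> V) (\<lambda>x. matrix_inv (gram (U, \<phi>) x) $ i $ j)" for i j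
    by (rule continuous_on_subset[OF gram_inv_continuous[OF c(1)]]) simp
  moreover have "continuous_on (U \<inter> V) (\<lambda>x. \<psi> (D x (coord_vec (U, \<phi>) x u) \<sigma>))" for u
    using connection_smooth[OF s c(1) V(1), of u] by (intro smooth_map_on_continuous_on o) simp
  then have "continuous_on (U \<inter> V) (\<lambda>x. fm (D x (coord_vec (U, \<phi>) x (axis i 1)) \<sigma>)
      (D x (coord_vec (U, \<phi>) x (axis j 1)) \<sigma>))" for i j
    by (intro fm_continuous[OF V(1)] connection_fibre[OF s] coord_vec_tangent[OF c(1)]) auto
  ultimately have "continuous_on (U \<inter> V) (\<lambda>x. \<Sum>i\<in>UNIV. \<Sum>j\<in>UNIV. matrix_inv (gram (U, \<phi>) x) $ i $ j *
    fm (D x (coord_vec (U, \<phi>) x (axis i 1)) \<sigma>) (D x (coord_vec (U, \<phi>) x (axis j 1)) \<sigma>))"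
    by (intro continuous_on_sum continuous_on_mult)
  then have "continuous_on (U \<inter> V) (deriv_norm_sq \<sigma>)"
    by (rule continuous_on_eq) (simp add: deriv_norm_sq_coord[OF c(1) _ s])
  then show "isCont (deriv_norm_sq \<sigma>) x"
    using continuous_on_eq_continuous_at o c(2) V(2) by blast
qed

end


section \<open>The Riemannian volume of a compact manifold\<close>

context oriented_riemannian_manifold
begin

definition density_in :: "('a, 'n) chart \<Rightarrow> real^'n \<Rightarrow> real" where
  "density_in c y = sqrt (det (gram c (inv_into (fst c) (snd c) y)))"

text \<open>The chart volume is pushed forward to a measure on the whole manifold, so that chart
  volumes can be compared and glued. The density vanishes off the chart image, so the points sent to
  \<open>undefined\<close> carry no mass.\<close>

definition vol_in :: "('a, 'n) chart \<Rightarrow> 'a measure" where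
  "vol_in c = distr
    (density lborel (\<lambda>y. ennreal (indicator (snd c ` fst c) y * density_in c y))) borel
    (\<lambda>y. if y \<in> snd c ` fst c then inv_into (fst c) (snd c) y else undefined)"

lemma sets_vol_in [simp, measurable_cong]: "sets (vol_in c) = sets borel"
  by (simp add: vol_in_def)

lemma density_in_pos:
  assumes "(U, \<phi>) \<in> atlas" "y \<in> \<phi> ` U"
  shows "density_in (U, \<phi>) y > 0"
  using posdef_det[OF posdef_gram[OF assms(1) chart_inv_in[OF assms(2) _ assms(1)]]]
  by (simp add: density_in_def)

lemma density_in_continuous:
  assumes "(U, \<phi>) \<in> atlas"
  shows "continuous_on (\<phi> ` U) (density_in (U, \<phi>))"
proof -
  have "continuous_on (\<phi> ` U) (\<lambda>y. gram (U, \<phi>) (inv_into U \<phi> y) $ i $ j)" for i j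
    by (rule continuous_on_compose2[OF gram_continuous[OF assms] chart_facts(2)[OF assms]])
      (use chart_inv_in[OF _ _ assms] in auto)
  then show ?thesis
    unfolding density_in_def fst_conv snd_conv
    by (intro continuous_on_real_sqrt continuous_on_det)
qed

lemma density_in_measurable [measurable]:
  assumes "(U, \<phi>) \<in> atlas"
  shows "(\<lambda>y. indicator (\<phi> ` U) y * density_in (U, \<phi>) y) \<in> borel_measurable borel"
  using borel_measurable_continuous_on_indicator[OF _ density_in_continuous[OF assms]] chart_image_open[OF assms]
  by simp

lemma chart_inverse_measurable:
  assumes "(U, \<phi>) \<in> atlas"
  shows "(\<lambda>y. if y \<in> \<phi> ` U then inv_into U \<phi> y else undefined) \<in> borel_measurable borel"
  by (rule borel_measurable_continuous_on_if)
    (simp_all add: chart_image_open[OF assms] chart_facts(2)[OF assms])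

text \<open>The image under a chart is a preimage under the inverse chart, and the latter is
  measurable.\<close>

lemma chart_image_borel:
  assumes c: "(U, \<phi>) \<in> atlas" and A: "A \<in> sets borel" "A \<subseteq> U"
  shows "\<phi> ` A \<in> sets borel"
proof -
  let ?T = "\<lambda>y. if y \<in> \<phi> ` U then inv_into U \<phi> y else undefined"
  have "?T -` A \<inter> \<phi> ` U \<in> sets borel"
    using measurable_sets[OF chart_inverse_measurable[OF c] A(1)] chart_image_open[OF c] by simp
  also have "?T -` A \<inter> \<phi> ` U = \<phi> ` A"
    using A(2) chart_facts(4)[OF c] by (auto intro!: image_eqI)
  finally show ?thesis .
qed

lemma emeasure_vol_in:
  assumes c: "(U, \<phi>) \<in> atlas" and A: "A \<in> sets borel" "A \<subseteq> U"
  shows "emeasure (vol_in (U, \<phi>)) A = (\<integral>\<^sup>+ y. ennreal (density_in (U, \<phi>) y) * indicator (\<phi> ` A) y \<partial>lborel)"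
proof -
  let ?T = "\<lambda>y. if y \<in> \<phi> ` U then inv_into U \<phi> y else undefined"
  note [measurable] = density_in_measurable[OF c] chart_inverse_measurable[OF c] A(1)
  have "emeasure (vol_in (U, \<phi>)) A
      = (\<integral>\<^sup>+ y. ennreal (indicator (\<phi> ` U) y * density_in (U, \<phi>) y) * indicator (?T -` A) y \<partial>lborel)"
  proof -
    have "emeasure (vol_in (U, \<phi>)) A
        = emeasure (density lborel (\<lambda>y. ennreal (indicator (\<phi> ` U) y * density_in (U, \<phi>) y))) (?T -` A)"
      unfolding vol_in_def fst_conv snd_conv by (subst emeasure_distr) simp_all
    then show ?thesis
      using measurable_sets[OF chart_inverse_measurable[OF c] A(1)] by (simp add: emeasure_density)
  qed
  also have "\<dots> = (\<integral>\<^sup>+ y. ennreal (density_in (U, \<phi>) y) * indicator (\<phi> ` A) y \<partial>lborel)"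
    by (intro nn_integral_cong)
      (use A(2) chart_facts(4)[OF c] in \<open>auto simp: indicator_def subset_iff split: if_splits\<close>)
  finally show ?thesis .
qed

lemma gram_change:
  assumes c: "(U, \<phi>) \<in> atlas" "x \<in> U" and c': "(V, \<phi>') \<in> atlas" "x \<in> V"
  defines "J \<equiv> matrix (frechet_derivative (\<phi>' \<circ> inv_into U \<phi>) (at (\<phi> x)))"
  shows "gram (U, \<phi>) x = transpose J ** (gram (V, \<phi>') x ** J)"
proof -
  have "gram (U, \<phi>) x $ i $ j = (\<chi> k. J $ k $ i) \<bullet> (gram (V, \<phi>') x *v (\<chi> k. J $ k $ j))" for i j
  proof -
    have "(\<chi> k. J $ k $ i) = frechet_derivative (\<phi>' \<circ> inv_into U \<phi>) (at (\<phi> x)) (axis i 1)" for i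
      by (simp add: J_def matrix_def vec_eq_iff)
    moreover have "gram (U, \<phi>) x $ i $ j
        = g x (coord_vec (U, \<phi>) x (axis i 1)) (coord_vec (U, \<phi>) x (axis j 1))"
      by (simp add: gram_def)
    ultimately show ?thesis
      by (simp only: coord_vec_change[OF c c'] g_coord_vec[OF c'])
  qed
  then show ?thesis
    unfolding inner_matrix_vector_sum
    by (simp add: vec_eq_iff matrix_matrix_mult_def transpose_def sum_distrib_left mult_ac)
qed

text \<open>The Gram determinant changes by the square of the Jacobian determinant. Its root
  therefore absorbs exactly the factor that appears in the change of variables.\<close>

lemma vol_in_compatible:
  assumes c: "(U, \<phi>) \<in> atlas" and c': "(V, \<phi>') \<in> atlas" and A: "A \<in> sets borel" "A \<subseteq> U" "A \<subseteq> V"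
  shows "emeasure (vol_in (U, \<phi>)) A = emeasure (vol_in (V, \<phi>')) A"
proof -
  let ?h = "\<phi>' \<circ> inv_into U \<phi>"
  let ?h' = "\<lambda>y. frechet_derivative ?h (at y)"
  have img: "?h ` (\<phi> ` A) = \<phi>' ` A"
    using A(2) chart_facts(4)[OF c] by (auto simp: image_comp intro!: image_cong)
  have dens: "\<bar>det (matrix (?h' y))\<bar> * density_in (V, \<phi>') (?h y) = density_in (U, \<phi>) y"
    if "y \<in> \<phi> ` A" for y
  proof -
    obtain x where x: "x \<in> A" "y = \<phi> x" using \<open>y \<in> \<phi> ` A\<close> by blast
    have i: "inv_into U \<phi> (\<phi> x) = x" "inv_into V \<phi>' (\<phi>' x) = x"
      using chart_facts(4)[OF c] chart_facts(4)[OF c'] x A by auto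
    have "det (gram (U, \<phi>) x) = (det (matrix (?h' y)))\<^sup>2 * det (gram (V, \<phi>') x)"
    proof -
      have "x \<in> U" "x \<in> V" using x A by auto
      then show ?thesis
        unfolding x(2) gram_change[OF c \<open>x \<in> U\<close> c' \<open>x \<in> V\<close>]
        by (simp add: det_mul power2_eq_square mult_ac)
    qed
    then show ?thesis by (simp add: density_in_def x(2) i real_sqrt_mult)
  qed
  have "emeasure (vol_in (V, \<phi>')) A
      = (\<integral>\<^sup>+ y. ennreal (density_in (V, \<phi>') y) * indicator (?h ` (\<phi> ` A)) y \<partial>lborel)"
    unfolding img by (rule emeasure_vol_in[OF c' A(1,3)])
  also have "\<dots> = (\<integral>\<^sup>+ y. ennreal (\<bar>det (matrix (?h' y))\<bar> * density_in (V, \<phi>') (?h y)) * indicator (\<phi> ` A) y \<partial>lborel)"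
  proof (rule nn_integral_change_of_variables)
    show "\<phi> ` A \<in> sets borel" by (rule chart_image_borel[OF c A(1,2)])
    show "(?h has_derivative ?h' y) (at y within \<phi> ` A)" if "y \<in> \<phi> ` A" for y
    proof -
      obtain x where "x \<in> A" "y = \<phi> x" using \<open>y \<in> \<phi> ` A\<close> by blast
      then show ?thesis
        using chart_change_has_derivative[OF c c', of x] A by (auto intro: has_derivative_at_withinI)
    qed
    show "inj_on ?h (\<phi> ` A)"
    proof (rule comp_inj_on)
      show "inj_on (inv_into U \<phi>) (\<phi> ` A)" using A(2) by (intro inj_on_inv_into) auto
      show "inj_on \<phi>' (inv_into U \<phi> ` \<phi> ` A)"
        using chart_inv_in[OF _ A(2) c] A(3) by (intro inj_on_subset[OF chart_facts(3)[OF c']]) auto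
    qed
    show "0 \<le> density_in (V, \<phi>') y" if "y \<in> ?h ` (\<phi> ` A)" for y
      using density_in_pos[OF c', of y] that A(3) unfolding img by (auto simp: less_imp_le)
    have "(\<lambda>y. indicator (\<phi>' ` A) y * (indicator (\<phi>' ` V) y * density_in (V, \<phi>') y)) \<in> borel_measurable borel"
      using chart_image_borel[OF c' A(1,3)] density_in_measurable[OF c'] by simp
    also have "(\<lambda>y. indicator (\<phi>' ` A) y * (indicator (\<phi>' ` V) y * density_in (V, \<phi>') y))
        = (\<lambda>y. indicator (\<phi>' ` A) y * density_in (V, \<phi>') y)"
      using A(3) by (auto simp: indicator_def fun_eq_iff)
    finally show "(\<lambda>y. indicator (?h ` (\<phi> ` A)) y * density_in (V, \<phi>') y) \<in> borel_measurable borel"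
      unfolding img .
    have "(\<lambda>y. indicator (\<phi> ` A) y * (indicator (\<phi> ` U) y * density_in (U, \<phi>) y)) \<in> borel_measurable borel"
      using chart_image_borel[OF c A(1,2)] density_in_measurable[OF c] by simp
    also have "(\<lambda>y. indicator (\<phi> ` A) y * (indicator (\<phi> ` U) y * density_in (U, \<phi>) y))
        = (\<lambda>y. indicator (\<phi> ` A) y * (\<bar>det (matrix (?h' y))\<bar> * density_in (V, \<phi>') (?h y)))"
    proof
      fix y
      show "indicator (\<phi> ` A) y * (indicator (\<phi> ` U) y * density_in (U, \<phi>) y)
        = indicator (\<phi> ` A) y * (\<bar>det (matrix (?h' y))\<bar> * density_in (V, \<phi>') (?h y))"
        using A(2) dens[of y] by (cases "y \<in> \<phi> ` A") (auto simp del: o_apply)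
    qed
    finally show "(\<lambda>y. indicator (\<phi> ` A) y * (\<bar>det (matrix (?h' y))\<bar> * density_in (V, \<phi>') (?h y))) \<in> borel_measurable borel" .
  qed
  also have "\<dots> = (\<integral>\<^sup>+ y. ennreal (density_in (U, \<phi>) y) * indicator (\<phi> ` A) y \<partial>lborel)"
    by (intro nn_integral_cong) (auto simp: indicator_def dens simp del: o_apply)
  also have "\<dots> = emeasure (vol_in (U, \<phi>)) A"
    by (rule emeasure_vol_in[OF c A(1,2), symmetric])
  finally show ?thesis ..
qed

text \<open>A whole chart domain may have infinite volume. The preimage of a ball whose closure lies
  in the chart image does not, as the density is bounded on the closed ball.\<close>

lemma finite_volume_neighbourhood:
  assumes c: "(U, \<phi>) \<in> atlas" "x \<in> U"
  shows "\<exists>B. open B \<and> x \<in> B \<and> B \<subseteq> U \<and> emeasure (vol_in (U, \<phi>)) B < \<infinity>"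
proof -
  obtain r where r: "r > 0" "cball (\<phi> x) r \<subseteq> \<phi> ` U"
    using open_contains_cball chart_image_open[OF c(1)] c(2) by (metis image_eqI)
  obtain C where C: "\<And>y. y \<in> cball (\<phi> x) r \<Longrightarrow> density_in (U, \<phi>) y \<le> C"
    using continuous_attains_sup[of "cball (\<phi> x) r" "density_in (U, \<phi>)"] r
      continuous_on_subset[OF density_in_continuous[OF c(1)] r(2)] by fastforce
  define B where "B = U \<inter> \<phi> -` ball (\<phi> x) r"
  have o: "open B"
    unfolding B_def by (rule continuous_open_preimage[OF chart_facts(1)[OF c(1)] chart_open[OF c(1)] open_ball])
  have img: "\<phi> ` B = ball (\<phi> x) r"
    using r(2) ball_subset_cball[of "\<phi> x" r] unfolding B_def by blast
  have "emeasure (vol_in (U, \<phi>)) B = (\<integral>\<^sup>+ y. ennreal (density_in (U, \<phi>) y) * indicator (ball (\<phi> x) r) y \<partial>lborel)"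
    using o emeasure_vol_in[OF c(1), of B] by (simp add: img) (simp add: B_def)
  also have "\<dots> \<le> (\<integral>\<^sup>+ y. ennreal C * indicator (ball (\<phi> x) r) y \<partial>lborel)"
    by (intro nn_integral_mono) (auto simp: indicator_def intro!: ennreal_leI C)
  also have "\<dots> = ennreal C * emeasure lborel (ball (\<phi> x) r)"
    by (rule nn_integral_cmult_indicator) simp
  also have "\<dots> < \<infinity>"
    using emeasure_lborel_ball_finite[of "\<phi> x" r] by (simp add: ennreal_mult_less_top)
  finally show ?thesis using o c(2) r(1) by (intro exI[of _ B]) (auto simp: B_def)
qed

definition is_riemannian_volume :: "'a measure \<Rightarrow> bool" where
  "is_riemannian_volume \<mu> \<longleftrightarrow> sets \<mu> = sets borel \<and>
     (\<forall>c\<in>atlas. \<forall>A\<in>sets borel. A \<subseteq> fst c \<longrightarrow> emeasure \<mu> A = emeasure (vol_in c) A)"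

lemma vol_alt: "vol = (THE \<mu>. is_riemannian_volume \<mu>)"
proof -
  have "is_riemannian_volume \<mu> \<longleftrightarrow> sets \<mu> = sets borel \<and>
     (\<forall>(U, \<phi>)\<in>atlas. \<forall>A\<in>sets borel. A \<subseteq> U \<longrightarrow>
        emeasure \<mu> A =
          (\<integral>\<^sup>+ y. ennreal (sqrt (det (gram (U, \<phi>) (inv_into U \<phi> y)))) * indicator (\<phi> ` A) y
             \<partial>lborel))" for \<mu>
    unfolding is_riemannian_volume_def
  proof (intro conj_cong refl ball_cong)
    fix c assume "c \<in> atlas"
    then show "(\<forall>A\<in>sets borel. A \<subseteq> fst c \<longrightarrow> emeasure \<mu> A = emeasure (vol_in c) A) =
      (case c of (U, \<phi>) \<Rightarrow> \<forall>A\<in>sets borel. A \<subseteq> U \<longrightarrow> emeasure \<mu> A =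
          (\<integral>\<^sup>+ y. ennreal (sqrt (det (gram (U, \<phi>) (inv_into U \<phi> y)))) * indicator (\<phi> ` A) y \<partial>lborel))"
      by (cases c) (simp add: emeasure_vol_in density_in_def)
  qed
  then show ?thesis unfolding vol_def by presburger
qed

text \<open>A definite description is only usable with existence and uniqueness, and the same finite
  partition yields both. Finiteness of the total volume comes from pieces inside neighbourhoods of
  finite volume.\<close>

lemma compact_vol:
  assumes "compact (UNIV :: 'a set)"
  shows "is_riemannian_volume vol" "emeasure vol UNIV < \<infinity>"
proof -
  have "\<exists>c B. c \<in> atlas \<and> open B \<and> x \<in> B \<and> B \<subseteq> fst c \<and> emeasure (vol_in c) B < \<infinity>" for x
  proof -
    obtain U \<phi> where c: "(U, \<phi>) \<in> atlas" "x \<in> U" by (rule chart_at)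
    from finite_volume_neighbourhood[OF this] c(1) show ?thesis
      by (intro exI[of _ "(U, \<phi>)"]) simp
  qed
  then obtain c B where cB: "\<And>x. c x \<in> atlas" "\<And>x. open (B x)" "\<And>x. x \<in> B x" "\<And>x. B x \<subseteq> fst (c x)"
    "\<And>x. emeasure (vol_in (c x)) (B x) < \<infinity>" by metis
  obtain X where X: "finite X" "UNIV \<subseteq> (\<Union>x\<in>X. B x)"
    by (rule compactE_image[OF assms, of UNIV B]) (use cB(2,3) in auto)
  obtain e and N :: nat where e: "X = e ` {i. i < N}" using finite_imp_nat_seg_image_inj_on[OF X(1)] by blast
  \<comment> \<open>Each set loses its predecessors; the pieces are Borel and still lie in a chart
    domain with finite volume.\<close>
  define E where "E = disjointed (\<lambda>i. B (e i))"
  let ?c = "\<lambda>i. c (e i)"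
  have UN: "(\<Union>i\<in>{..<N}. E i) = UNIV"
    using finite_UN_disjointed_eq[of "\<lambda>i. B (e i)" N] X(2) e unfolding E_def
    by (auto simp: atLeast0LessThan lessThan_def)
  have disj: "disjoint_family_on E {..<N}"
    using disjoint_family_disjointed[of "\<lambda>i. B (e i)"] unfolding E_def disjoint_family_on_def by blast
  have EB: "E i \<subseteq> B (e i)" for i unfolding E_def by (rule disjointed_subset)
  have E [measurable]: "E i \<in> sets borel" for i
  proof -
    have "range (\<lambda>i. B (e i)) \<subseteq> sets borel" using cB(2) by auto
    from sets.range_disjointed_sets[OF this] show ?thesis unfolding E_def by blast
  qed
  have split: "emeasure \<nu> A = (\<Sum>i<N. emeasure \<nu> (A \<inter> E i))"
    if \<nu>: "sets \<nu> = sets borel" and A: "A \<in> sets borel" for \<nu> :: "'a measure" and A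
  proof -
    have "(\<Sum>i<N. emeasure \<nu> (A \<inter> E i)) = emeasure \<nu> (\<Union>i<N. A \<inter> E i)"
      using disj A by (intro sum_emeasure) (auto simp: \<nu> disjoint_family_on_def)
    also have "(\<Union>i<N. A \<inter> E i) = A" using UN by auto
    finally show ?thesis ..
  qed
  define m where "m A = (\<Sum>i<N. emeasure (vol_in (?c i)) (A \<inter> E i))" for A
  define \<mu> where "\<mu> = measure_of UNIV (sets borel) m"
  have s: "sets \<mu> = sets borel"
    unfolding \<mu>_def using sets.sigma_sets_eq[of "borel :: 'a measure"] by simp
  have \<mu>: "emeasure \<mu> A = m A" if "A \<in> sets borel" for A
  proof (rule emeasure_measure_of[OF \<mu>_def])
    show "positive (sets \<mu>) m" by (simp add: positive_def m_def)
    show "countably_additive (sets \<mu>) m"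
      unfolding s
    proof (rule countably_additiveI)
      fix A :: "nat \<Rightarrow> 'a set" assume A: "range A \<subseteq> sets borel" "disjoint_family A"
      have "(\<Sum>n. m (A n)) = (\<Sum>i<N. \<Sum>n. emeasure (vol_in (?c i)) (A n \<inter> E i))"
        unfolding m_def by (intro suminf_sum summableI)
      also have "\<dots> = (\<Sum>i<N. emeasure (vol_in (?c i)) (\<Union>n. A n \<inter> E i))"
        using A by (intro sum.cong refl suminf_emeasure) (auto simp: disjoint_family_on_def)
      also have "\<dots> = m (\<Union>n. A n)" by (simp add: m_def)
      finally show "(\<Sum>n. m (A n)) = m (\<Union>n. A n)" .
    qed
  qed (use that s in auto)
  \<comment> \<open>Uniqueness: on each piece the value is prescribed by a chart, and finite
    additivity leaves no freedom.\<close>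
  have eq: "emeasure \<nu> A = m A" if \<nu>: "is_riemannian_volume \<nu>" and A: "A \<in> sets borel" for \<nu> A
  proof -
    have "emeasure \<nu> (A \<inter> E i) = emeasure (vol_in (?c i)) (A \<inter> E i)" for i
      using \<nu> A cB(1) EB[of i] cB(4)[of "e i"] unfolding is_riemannian_volume_def by (meson E Int_lower2 order_trans sets.Int)
    then show ?thesis
      using split[of \<nu> A] \<nu> A unfolding m_def is_riemannian_volume_def by simp
  qed
  \<comment> \<open>A set inside an arbitrary chart \<open>k\<close> is cut along the partition, and
    \<open>vol_in_compatible\<close> exchanges \<open>k\<close> for the chart of each piece.\<close>
  have spec: "is_riemannian_volume \<mu>"
    unfolding is_riemannian_volume_def
  proof (intro conjI ballI impI s)
    fix k A assume k: "k \<in> atlas" and A: "A \<in> sets borel" "A \<subseteq> fst k"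
    have "emeasure (vol_in k) A = (\<Sum>i<N. emeasure (vol_in k) (A \<inter> E i))"
      by (rule split) (simp_all add: A)
    also have "\<dots> = m A"
      unfolding m_def
    proof (intro sum.cong refl)
      fix i
      show "emeasure (vol_in k) (A \<inter> E i) = emeasure (vol_in (?c i)) (A \<inter> E i)"
        using vol_in_compatible[of "fst k" "snd k" "fst (?c i)" "snd (?c i)" "A \<inter> E i"]
          k cB(1) A EB[of i] cB(4)[of "e i"] by auto
    qed
    finally show "emeasure \<mu> A = emeasure (vol_in k) A" using \<mu> A by simp
  qed
  have "vol = \<mu>"
    unfolding vol_alt
  proof (rule the_equality)
    show "is_riemannian_volume \<mu>" by (rule spec)
    fix \<nu> assume \<nu>: "is_riemannian_volume \<nu>"
    have "sets \<nu> = sets borel" using \<nu> by (simp add: is_riemannian_volume_def)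
    then show "\<nu> = \<mu>" by (intro measure_eqI) (simp_all add: s eq[OF \<nu>] \<mu>)
  qed
  then show "is_riemannian_volume vol" using spec by simp
  have "emeasure (vol_in (?c i)) (E i) < \<infinity>" for i
    using emeasure_mono[OF EB[of i], of "vol_in (?c i)"] cB(2,5)[of "e i"] by (auto intro: le_less_trans)
  then show "emeasure vol UNIV < \<infinity>"
    unfolding \<open>vol = \<mu>\<close> by (simp add: \<mu> m_def)
qed

text \<open>The density is positive throughout a chart image, so a null open set would have an open
  Lebesgue null set as its image, hence an empty one.\<close>

lemma vol_open_pos:
  assumes vol: "is_riemannian_volume vol" and W: "open W" "W \<noteq> {}"
  shows "emeasure vol W > 0"
proof (rule ccontr)
  assume "\<not> emeasure vol W > 0"
  then have 0: "emeasure vol W = 0" by simp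
  obtain x where x: "x \<in> W" using W(2) by blast
  obtain U \<phi> where c: "(U, \<phi>) \<in> atlas" "x \<in> U" by (rule chart_at)
  have o: "open (U \<inter> W)" by (intro open_Int chart_open[OF c(1)] W(1))
  have [measurable]: "(\<lambda>y. indicator (\<phi> ` (U \<inter> W)) y * density_in (U, \<phi>) y) \<in> borel_measurable borel"
    using borel_measurable_continuous_on_indicator[OF _ continuous_on_subset[OF density_in_continuous[OF c(1)]], of "\<phi> ` (U \<inter> W)"]
      open_chart_image[OF c(1) W(1)] by auto
  have sets: "sets vol = sets borel" using vol by (simp add: is_riemannian_volume_def)
  have "emeasure vol (U \<inter> W) \<le> emeasure vol W"
    by (intro emeasure_mono) (simp_all add: sets W(1))
  then have "emeasure vol (U \<inter> W) = 0" using 0 by simp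
  then have "emeasure (vol_in (U, \<phi>)) (U \<inter> W) = 0"
    using vol c(1) o unfolding is_riemannian_volume_def by fastforce
  then have "(\<integral>\<^sup>+ y. ennreal (indicator (\<phi> ` (U \<inter> W)) y * density_in (U, \<phi>) y) \<partial>lborel) = 0"
    using emeasure_vol_in[OF c(1), of "U \<inter> W"] o
    by (subst nn_integral_cong[of _ _ "\<lambda>y. ennreal (density_in (U, \<phi>) y) * indicator (\<phi> ` (U \<inter> W)) y"])
      (auto simp: indicator_def)
  then have "AE y in lborel. ennreal (indicator (\<phi> ` (U \<inter> W)) y * density_in (U, \<phi>) y) = 0"
    by (subst (asm) nn_integral_0_iff_AE) simp_all
  then have "AE y in lborel. y \<notin> \<phi> ` (U \<inter> W)"
  proof (rule AE_mp, intro AE_I2 impI notI)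
    fix y assume y: "y \<in> \<phi> ` (U \<inter> W)"
      and z: "ennreal (indicator (\<phi> ` (U \<inter> W)) y * density_in (U, \<phi>) y) = 0"
    have "density_in (U, \<phi>) y > 0" using y by (intro density_in_pos[OF c(1)]) auto
    then show False using z y by (simp add: ennreal_eq_0_iff)
  qed
  then have "\<phi> ` (U \<inter> W) \<in> null_sets lborel"
    using open_chart_image[OF c(1) W(1)] by (simp add: AE_iff_null_sets)
  then have "negligible (\<phi> ` (U \<inter> W))"
    by (simp add: negligible_iff_null_sets null_sets_completionI)
  then show False
    using open_not_negligible[OF open_chart_image[OF c(1) W(1)]] c(2) x by auto
qed

lemma compact_integrable:
  fixes f :: "'a \<Rightarrow> real"
  assumes comp: "compact (UNIV :: 'a set)" and f: "continuous_on UNIV f"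
  shows "integrable vol f"
proof -
  have sets: "sets vol = sets borel" using compact_vol(1)[OF comp] by (simp add: is_riemannian_volume_def)
  interpret finite_measure vol
    using compact_vol(2)[OF comp] sets sets_eq_imp_space_eq[OF sets] by (intro finite_measureI) auto
  obtain C where "\<And>x. norm (f x) \<le> C"
    using compact_imp_bounded[OF compact_continuous_image[OF f comp]] unfolding bounded_iff by auto
  then show ?thesis
    using f by (intro integrable_const_bound[of _ C])
      (simp_all add: measurable_cong_sets[OF sets] borel_measurable_continuous_onI)
qed

text \<open>The function vanishes almost everywhere, and by continuity the exceptional set is open;
  \<open>vol_open_pos\<close> leaves only the empty set.\<close>

lemma compact_integral_eq_0:
  fixes f :: "'a \<Rightarrow> real"
  assumes comp: "compact (UNIV :: 'a set)" and f: "continuous_on UNIV f" "\<And>x. 0 \<le> f x"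
    and "integral\<^sup>L vol f = 0"
  shows "f x = 0"
proof (rule ccontr)
  assume "f x \<noteq> 0"
  have sets: "sets vol = sets borel" using compact_vol(1)[OF comp] by (simp add: is_riemannian_volume_def)
  have o: "open {x. f x \<noteq> 0}"
    by (intro open_Collect_neq f continuous_on_const)
  have "AE x in vol. f x = 0"
    using integral_nonneg_eq_0_iff_AE[OF compact_integrable[OF comp f(1)]] assms(3,4) by simp
  then have "emeasure vol {x. f x \<noteq> 0} = 0"
    using AE_iff_measurable[of "{x. f x \<noteq> 0}" vol "\<lambda>x. f x = 0"] o sets_eq_imp_space_eq[OF sets] by (simp add: sets)
  moreover have "emeasure vol {x. f x \<noteq> 0} > 0"
    using \<open>f x \<noteq> 0\<close> by (intro vol_open_pos[OF compact_vol(1)[OF comp] o]) auto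
  ultimately show False by simp
qed

end


section \<open>The gradient part of the vertical energy\<close>

context riemannian_vector_bundle_with_connection
begin

text \<open>The chain rule gives \<open>H'\<close> times \<open>df\<close>, and the squared norm is
  quadratic. Smoothness of the composite ensures that tangent vectors act on it by differentiation
  and not by their default value 0.\<close>

lemma grad_norm_sq_compose:
  assumes f: "smooth_map_on UNIV f" and H: "smooth_map_on UNIV (\<lambda>x. H (f x))"
    and H': "(H has_real_derivative H') (at (f x))"
  shows "grad_norm_sq (\<lambda>x. H (f x)) x = H'\<^sup>2 * grad_norm_sq f x"
proof -
  obtain U \<phi> where c: "(U, \<phi>) \<in> atlas" "x \<in> U" by (rule chart_at)
  let ?i = "inv_into U \<phi>"
  have d: "(f \<circ> ?i has_derivative frechet_derivative (f \<circ> ?i) (at (\<phi> x))) (at (\<phi> x))"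
    by (rule smooth_near_has_derivative[OF c smooth_imp_near[OF f]])
  have "(H has_derivative (*) H') (at ((f \<circ> ?i) (\<phi> x)))"
    using H' chart_facts(4)[OF c(1) c(2)] by (simp add: has_field_derivative_def)
  from diff_chain_at[OF d this]
  have "((\<lambda>x. H (f x)) \<circ> ?i has_derivative (*) H' \<circ> frechet_derivative (f \<circ> ?i) (at (\<phi> x))) (at (\<phi> x))"
    by (simp add: o_def)
  then have "frechet_derivative ((\<lambda>x. H (f x)) \<circ> ?i) (at (\<phi> x)) = (*) H' \<circ> frechet_derivative (f \<circ> ?i) (at (\<phi> x))"
    by (rule frechet_derivative_at[symmetric])
  then have "chart_gradient (U, \<phi>) (\<lambda>x. H (f x)) x = H' *\<^sub>R chart_gradient (U, \<phi>) f x"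
    by (simp add: chart_gradient_def coord_vec_def vec_eq_iff smooth_imp_near[OF f] smooth_imp_near[OF H])
  then show ?thesis
    by (simp add: grad_norm_sq_def grad_inner_coord[OF c] matrix_vector_mult_scaleR power2_eq_square)
qed

definition gradient_energy :: "real \<Rightarrow> ('a \<Rightarrow> 'e) \<Rightarrow> real" where
  "gradient_energy p \<sigma> =
     (\<integral>x. (1 + 2 * half_square_length \<sigma> x) powr (- p) * grad_norm_sq (half_square_length \<sigma>) x \<partial>vol)"

lemma half_square_length_nonneg: "0 \<le> half_square_length \<sigma> x"
  by (simp add: half_square_length_def)

lemma half_square_length_scale:
  "half_square_length (\<lambda>x. scale (s x) (\<sigma> x)) x = (s x)\<^sup>2 * half_square_length \<sigma> x"
  by (simp add: half_square_length_def fibre_norm_sq fm_scale) (simp add: power2_eq_square)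

lemma weight_continuous:
  assumes "smooth_section \<sigma>"
  shows "continuous_on UNIV (\<lambda>x. (1 + 2 * half_square_length \<sigma> x) powr r)"
proof -
  have "1 + 2 * half_square_length \<sigma> x \<noteq> 0" for x
    using half_square_length_nonneg[of \<sigma> x] by linarith
  then show ?thesis
    by (intro continuous_intros smooth_map_on_continuous_on[OF _ smooth_half_square_length[OF assms]]) auto
qed

lemma gradient_energy_continuous:
  assumes "smooth_section \<sigma>"
  shows "continuous_on UNIV (\<lambda>x. (1 + 2 * half_square_length \<sigma> x) powr (- p) * grad_norm_sq (half_square_length \<sigma>) x)"
  unfolding grad_norm_sq_def
  by (intro continuous_on_mult weight_continuous grad_inner_continuous smooth_half_square_length assms)

lemma vertical_energy_diff:
  assumes comp: "compact (UNIV :: 'a set)" and s: "smooth_section \<sigma>"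
  shows "vertical_energy p q \<sigma> - vertical_energy p q' \<sigma> = (q - q') / 2 * gradient_energy p \<sigma>"
proof -
  let ?w = "\<lambda>x. (1 + 2 * half_square_length \<sigma> x) powr (- p)"
  let ?G = "grad_norm_sq (half_square_length \<sigma>)"
  have w: "1 / (1 + (fibre_norm (\<sigma> x))\<^sup>2) powr p = ?w x" for x
    by (simp add: half_square_length_def powr_minus_divide)
  have int_d: "integrable vol (\<lambda>x. ?w x * deriv_norm_sq \<sigma> x)"
    by (intro compact_integrable comp continuous_on_mult weight_continuous deriv_norm_sq_continuous s)
  have int_g: "integrable vol (\<lambda>x. ?w x * ?G x)"
    by (intro compact_integrable comp gradient_energy_continuous s)
  define a where "a = (\<integral>x. ?w x * deriv_norm_sq \<sigma> x \<partial>vol)"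
  have "vertical_energy p q \<sigma> = 1 / 2 * (a + q * gradient_energy p \<sigma>)" for q
  proof -
    have "(\<integral>x. ?w x * (deriv_norm_sq \<sigma> x + q * ?G x) \<partial>vol)
        = (\<integral>x. ?w x * deriv_norm_sq \<sigma> x + q * (?w x * ?G x) \<partial>vol)"
      by (intro Bochner_Integration.integral_cong refl) (simp only: distrib_left mult.left_commute)
    also have "\<dots> = (\<integral>x. ?w x * deriv_norm_sq \<sigma> x \<partial>vol) + (\<integral>x. q * (?w x * ?G x) \<partial>vol)"
      using int_d integrable_mult_right[OF int_g] by (rule Bochner_Integration.integral_add)
    also have "(\<integral>x. q * (?w x * ?G x) \<partial>vol) = q * gradient_energy p \<sigma>"
      unfolding gradient_energy_def by (rule integral_mult_right_zero)
    finally show ?thesis unfolding vertical_energy_def w a_def by (rule arg_cong)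
  qed
  then show ?thesis by (simp add: field_simps)
qed

lemma gradient_energy_nonneg: "0 \<le> gradient_energy p \<sigma>"
  unfolding gradient_energy_def grad_norm_sq_def
  by (intro Bochner_Integration.integral_nonneg mult_nonneg_nonneg grad_inner_nonneg) simp

text \<open>The variation \<open>(1 + t (1 + |\<sigma>|\<^sup>2)\<^sup>m) \<sigma>\<close> maps fibres radially, so that all quantities in the
  gradient energy are functions of \<open>|\<sigma>|\<^sup>2\<close> times the original gradient.\<close>

lemma gradient_energy_growth:
  assumes comp: "compact (UNIV :: 'a set)" and s: "smooth_section \<sigma>" and m: "\<bar>p\<bar> \<le> real m"
  defines "S \<equiv> \<lambda>t x. scale (1 + t * (1 + 2 * half_square_length \<sigma> x) ^ m) (\<sigma> x)"
  obtains \<delta> where "\<delta> > 0"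
    "\<And>t. 0 \<le> t \<Longrightarrow> t \<le> \<delta> \<Longrightarrow> (1 + t) * gradient_energy p \<sigma> \<le> gradient_energy p (S t)"
proof -
  let ?F = "half_square_length \<sigma>"
  have F: "smooth_map_on UNIV ?F" by (rule smooth_half_square_length[OF s])
  have f: "smooth_map_on UNIV (\<lambda>x. (1 + 2 * ?F x) ^ m)"
    by (intro smooth_map_on_power smooth_map_on_add smooth_map_on_mult smooth_map_on_const F open_UNIV)
  have St: "smooth_section (S t)" for t
    unfolding S_def
    by (intro smooth_section_scale s smooth_map_on_add smooth_map_on_mult smooth_map_on_const f open_UNIV)
  have "continuous_on UNIV (\<lambda>x. (1 + 2 * ?F x) ^ m)"
    by (rule smooth_map_on_continuous_on[OF open_UNIV f])
  from compact_imp_bounded[OF compact_continuous_image[OF this comp]]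
  obtain C where C: "\<And>x. norm ((1 + 2 * ?F x) ^ m) \<le> C" unfolding bounded_iff by auto
  have C1: "(1 + 2 * ?F x) ^ m \<le> C" for x using C[of x] by simp
  have "1 \<le> (1 + 2 * ?F x) ^ m" for x using half_square_length_nonneg[of \<sigma> x] by (intro one_le_power) simp
  then have "1 \<le> C" using C1 order_trans by blast
  \<comment> \<open>The pointwise inequality needs
    \<open>t * C * (24 * (1 + m)\<^sup>2) \<le> 1\<close>, so \<open>1 / K\<close> is the largest
    admissible time.\<close>
  define K where "K = C * (24 * (1 + real m)\<^sup>2)"
  have K: "K > 0" using \<open>1 \<le> C\<close> by (simp add: K_def)
  show ?thesis
  proof (rule that[of "1 / K"])
    show "1 / K > 0" using K by simp
    fix t :: real assume t: "0 \<le> t" "t \<le> 1 / K"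
    then have tK: "t * C * (24 * (1 + real m)\<^sup>2) \<le> 1" using K by (simp add: K_def field_simps)
    let ?H = "\<lambda>r::real. (1 + t * (1 + 2 * r) ^ m)\<^sup>2 * r"
    let ?H' = "\<lambda>r::real. (1 + t * (1 + 2 * r) ^ m)\<^sup>2
      + 2 * (1 + t * (1 + 2 * r) ^ m) * (t * (2 * real m * (1 + 2 * r) ^ (m - 1))) * r"
    have HF: "half_square_length (S t) = (\<lambda>x. ?H (?F x))"
      by (rule ext) (simp add: S_def half_square_length_scale)
    have der: "(?H has_real_derivative ?H' r) (at r)" for r
      by (auto intro!: derivative_eq_intros simp: power2_eq_square algebra_simps)
    have G: "grad_norm_sq (half_square_length (S t)) x = (?H' (?F x))\<^sup>2 * grad_norm_sq ?F x" for x
      unfolding HF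
      by (rule grad_norm_sq_compose[OF F _ der]) (use smooth_half_square_length[OF St[of t]] HF in simp)
    have "(\<integral>x. (1 + t) * ((1 + 2 * ?F x) powr (- p) * grad_norm_sq ?F x) \<partial>vol) \<le> gradient_energy p (S t)"
      unfolding gradient_energy_def
    proof (rule integral_mono)
      show "integrable vol (\<lambda>x. (1 + t) * ((1 + 2 * ?F x) powr (- p) * grad_norm_sq ?F x))"
        by (intro integrable_mult_right compact_integrable comp gradient_energy_continuous s)
      show "integrable vol (\<lambda>x. (1 + 2 * half_square_length (S t) x) powr (- p) * grad_norm_sq (half_square_length (S t)) x)"
        by (intro compact_integrable comp gradient_energy_continuous St)
      fix x
      have "(1 + t) * (1 + 2 * ?F x) powr (- p) * grad_norm_sq ?F x
          \<le> (1 + 2 * ?H (?F x)) powr (- p) * (?H' (?F x))\<^sup>2 * grad_norm_sq ?F x"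
        using weighted_gradient_growth[OF m half_square_length_nonneg C1 t(1)] tK
        by (intro mult_right_mono) (simp_all add: grad_norm_sq_def grad_inner_nonneg)
      then show "(1 + t) * ((1 + 2 * ?F x) powr (- p) * grad_norm_sq ?F x)
          \<le> (1 + 2 * half_square_length (S t) x) powr (- p) * grad_norm_sq (half_square_length (S t)) x"
        unfolding G by (simp add: HF mult_ac)
    qed
    then show "(1 + t) * gradient_energy p \<sigma> \<le> gradient_energy p (S t)"
      by (simp add: gradient_energy_def)
  qed
qed

text \<open>Along the variation the difference of the two energies is a fixed nonzero multiple of
  the gradient energy, whose derivative at 0 is therefore 0. By the growth estimate its right
  difference quotients are at least the gradient energy of \<open>\<sigma>\<close>, which thus
  cannot be positive.\<close>

lemma harmonic_two_imp_gradient_energy_0: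
  assumes comp: "compact (UNIV :: 'a set)"
    and h: "harmonic_section p q \<sigma>" "harmonic_section p q' \<sigma>" and "q \<noteq> q'"
  shows "gradient_energy p \<sigma> = 0"
proof -
  have s: "smooth_section \<sigma>" using h by (simp add: harmonic_section_def)
  obtain m :: nat where m: "\<bar>p\<bar> \<le> real m" using real_arch_simple by blast
  let ?f = "\<lambda>x. (1 + 2 * half_square_length \<sigma> x) ^ m"
  define S where "S = (\<lambda>t x. scale (1 + t * ?f x) (\<sigma> x))"
  have f: "smooth_map_on UNIV ?f"
    by (intro smooth_map_on_power smooth_map_on_add smooth_map_on_mult smooth_map_on_const
        smooth_half_square_length[OF s] open_UNIV)
  have St: "smooth_section (S t)" for t
    unfolding S_def
    by (intro smooth_section_scale s smooth_map_on_add smooth_map_on_mult smooth_map_on_const f open_UNIV)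
  have var: "smooth_variation \<sigma> 1 S"
    unfolding S_def by (rule smooth_variation_scale[OF f s])
  have "((\<lambda>t. vertical_energy p q (S t) - vertical_energy p q' (S t)) has_real_derivative 0 - 0) (at 0)"
    using h var unfolding harmonic_section_def by (intro DERIV_diff) blast+
  then have "((\<lambda>t. (q - q') / 2 * gradient_energy p (S t)) has_real_derivative 0) (at 0)"
    by (simp add: vertical_energy_diff[OF comp St])
  then have "((\<lambda>t. 2 / (q - q') * ((q - q') / 2 * gradient_energy p (S t))) has_real_derivative 2 / (q - q') * 0) (at 0)"
    by (rule DERIV_cmult)
  then have der: "((\<lambda>t. gradient_energy p (S t)) has_real_derivative 0) (at 0)"
    using \<open>q \<noteq> q'\<close> by simp
  obtain \<delta> where \<delta>: "\<delta> > 0"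
    "\<And>t. 0 \<le> t \<Longrightarrow> t \<le> \<delta> \<Longrightarrow> (1 + t) * gradient_energy p \<sigma> \<le> gradient_energy p (S t)"
    using gradient_energy_growth[OF comp s m] unfolding S_def by blast
  have S0: "S 0 = \<sigma>" by (simp add: S_def scale_one)
  \<comment> \<open>The limit is restricted to positive times because the growth estimate holds only
    there.\<close>
  have lim: "((\<lambda>t. (gradient_energy p (S t) - gradient_energy p \<sigma>) / t) \<longlongrightarrow> 0) (at_right 0)"
  proof -
    have "((\<lambda>t. (gradient_energy p (S t) - gradient_energy p (S 0)) / (t - 0)) \<longlongrightarrow> 0) (at 0)"
      using der by (simp only: has_field_derivative_iff)
    then show ?thesis
      using tendsto_within_subset[OF _ subset_UNIV[of "{0<..}"]] by (simp add: S0)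
  qed
  have "gradient_energy p \<sigma> \<le> 0"
  proof (rule tendsto_lowerbound[OF lim])
    have "\<forall>\<^sub>F t in at_right 0. t \<in> {0<..<\<delta>}" 
      using \<delta>(1) by (intro eventually_at_rightI[of 0 \<delta>]) simp_all
    then show "\<forall>\<^sub>F t in at_right 0. gradient_energy p \<sigma> \<le> (gradient_energy p (S t) - gradient_energy p \<sigma>) / t"
    proof eventually_elim
      case (elim t)
      then have "(1 + t) * gradient_energy p \<sigma> \<le> gradient_energy p (S t)" by (intro \<delta>(2)) auto
      then show ?case using elim by (simp add: field_simps)
    qed
  qed simp
  then show ?thesis using gradient_energy_nonneg[of p \<sigma>] by simp
qed

text \<open>The weight is positive, so the gradient of F vanishes at every point. In charts this
  makes F locally constant, and connectedness does the rest.\<close>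

lemma gradient_energy_0_imp_constant:
  assumes comp: "compact (UNIV :: 'a set)" and conn: "connected (UNIV :: 'a set)"
    and s: "smooth_section \<sigma>" and 0: "gradient_energy p \<sigma> = 0"
  shows "\<exists>c. \<forall>x. fibre_norm (\<sigma> x) = c"
proof -
  let ?F = "half_square_length \<sigma>"
  have F: "smooth_map_on UNIV ?F" by (rule smooth_half_square_length[OF s])
  have grad: "grad_norm_sq ?F x = 0" for x
  proof -
    have "(1 + 2 * ?F x) powr (- p) * grad_norm_sq ?F x = 0"
      using 0 unfolding gradient_energy_def
      by (intro compact_integral_eq_0[OF comp gradient_energy_continuous[OF s]])
        (simp_all add: grad_norm_sq_def grad_inner_nonneg)
    moreover have "1 + 2 * ?F x > 0" using half_square_length_nonneg[of \<sigma> x] by linarith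
    ultimately show ?thesis by simp
  qed
  have "?F constant_on UNIV"
  proof (rule locally_constant_imp_constant[OF conn])
    fix x :: 'a
    obtain U \<phi> where c: "(U, \<phi>) \<in> atlas" "x \<in> U" by (rule chart_at)
    let ?i = "inv_into U \<phi>"
    \<comment> \<open>A ball is chosen because vanishing derivative forces constancy on convex sets,
      while the chart image itself may be disconnected.\<close>
    obtain r where r: "r > 0" "ball (\<phi> x) r \<subseteq> \<phi> ` U"
      using open_contains_ball chart_image_open[OF c(1)] c(2) by (metis image_eqI)
    have "((?F \<circ> ?i) has_derivative (\<lambda>h. 0)) (at y within ball (\<phi> x) r)" if "y \<in> ball (\<phi> x) r" for y
    proof -
      obtain z where z: "z \<in> U" "y = \<phi> z" using r(2) \<open>y \<in> ball (\<phi> x) r\<close> by blast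
      have "chart_gradient (U, \<phi>) ?F z = 0"
        using grad_inner_eq_0[OF c(1) z(1)] grad[of z] by (simp add: grad_norm_sq_def)
      then have "coord_vec (U, \<phi>) z u ?F = 0" for u by (simp add: coord_vec_eq_inner[OF c(1) z(1)])
      then have "frechet_derivative (?F \<circ> ?i) (at y) u = 0" for u
        by (simp only: coord_vec_def fst_conv snd_conv smooth_imp_near[OF F] if_True z(2))
      then have fr: "frechet_derivative (?F \<circ> ?i) (at y) = (\<lambda>h. 0)" by (rule ext)
      have "((?F \<circ> ?i) has_derivative frechet_derivative (?F \<circ> ?i) (at y)) (at y)"
        unfolding z(2) by (rule smooth_near_has_derivative[OF c(1) z(1) smooth_imp_near[OF F]])
      then show ?thesis unfolding fr by (rule has_derivative_at_withinI)
    qed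
    from has_derivative_zero_constant[OF convex_ball this]
    obtain k where k: "\<And>y. y \<in> ball (\<phi> x) r \<Longrightarrow> (?F \<circ> ?i) y = k" by blast
    let ?T = "U \<inter> \<phi> -` ball (\<phi> x) r"
    have "open ?T"
      by (rule continuous_open_preimage[OF chart_facts(1)[OF c(1)] chart_open[OF c(1)] open_ball])
    moreover have "\<forall>y\<in>?T. ?F y = ?F x"
    proof
      fix y assume y: "y \<in> ?T"
      have "?F z = k" if "z \<in> ?T" for z
        using k[of "\<phi> z"] that chart_facts(4)[OF c(1), of z] by simp
      from this[OF y] this[of x] show "?F y = ?F x" using r(1) c(2) by simp
    qed
    moreover have "x \<in> ?T" using c(2) r(1) by simp
    ultimately show "\<exists>T. openin (top_of_set UNIV) T \<and> x \<in> T \<and> (\<forall>y\<in>T. ?F y = ?F x)"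
      by (metis open_openin subtopology_UNIV)
  qed
  then obtain k where k: "\<And>x. ?F x = k" unfolding constant_on_def by auto
  have "fibre_norm (\<sigma> x) = sqrt (2 * k)" for x
    using k[of x] by (simp add: half_square_length_def fibre_norm_sq) (simp add: fibre_norm_def)
  then show ?thesis by blast
qed

end

theorem theorem4p8:
  fixes atlas :: "('a::{t2_space, second_countable_topology}, 'n::finite) chart set"
    and g :: "'a \<Rightarrow> (('a \<Rightarrow> real) \<Rightarrow> real) \<Rightarrow> (('a \<Rightarrow> real) \<Rightarrow> real) \<Rightarrow> real"
    and proj :: "'e \<Rightarrow> 'a"
    and add :: "'e \<Rightarrow> 'e \<Rightarrow> 'e"
    and scale :: "real \<Rightarrow> 'e \<Rightarrow> 'e"
    and triv :: "('a set \<times> ('e \<Rightarrow> real ^ 'k::finite)) set"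
    and fm :: "'e \<Rightarrow> 'e \<Rightarrow> real"
    and D :: "'a \<Rightarrow> (('a \<Rightarrow> real) \<Rightarrow> real) \<Rightarrow> ('a \<Rightarrow> 'e) \<Rightarrow> 'e"
    and \<sigma> :: "'a \<Rightarrow> 'e"
    and p :: real
  assumes "riemannian_vector_bundle_with_connection atlas g proj add scale triv fm D"
    and "connected (UNIV :: 'a set)"
    and "compact (UNIV :: 'a set)"
    and "oriented_vector_bundle.smooth_section atlas proj triv \<sigma>"
    and "\<not> (\<exists>c. \<forall>x. riemannian_vector_bundle_with_connection.fibre_norm fm (\<sigma> x) = c)"
  shows "\<exists>\<^sub>\<le>\<^sub>1 q :: real.
    riemannian_vector_bundle_with_connection.harmonic_section atlas g proj triv fm D p q \<sigma>"
proof (rule Uniq_I, rule ccontr)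
  interpret riemannian_vector_bundle_with_connection atlas g proj add scale triv fm D by fact
  fix q q'
  assume "harmonic_section p q \<sigma>" "harmonic_section p q' \<sigma>" "q \<noteq> q'"
  from harmonic_two_imp_gradient_energy_0[OF assms(3) this]
    gradient_energy_0_imp_constant[OF assms(3,2,4)] assms(5)
  show False by blast
qed

end
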